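(* Let $H$ and $U$ be Hilbert spaces, let $A$ generate a $C_0$ semigroup on $H$, let $B\in\mathcal{L}(U;H)$, and let $T>0$. Let $\mathcal{G}$ be a closed vector subspace of $L^2(0,T;U)$ and $\mathcal{W}$ a closed vector subspace of $L^2(0,T;H)$ (both possibly of infinite dimension). Assume that there exists $C>0$ such that for all $(z_T,g,w,f)\in H\times\mathcal{G}\times\mathcal{W}\times L^2(0,T;H)$, the solution $z$ of $z'+A^*z=f$ for $t\in(0,T)$, $z(T)=z_T$, satisfies $$\|(z_T,g,w,f)\|_{H\times\mathcal{G}\times\mathcal{W}\times L^2(0,T;H)}\le C\left(\|B^*z+g\|_{L^2(0,T;U)}+\|f+w\|_{L^2(0,T;H)}\right).$$ Then, for any $y_0,y_1\in H$, $g_*\in\mathcal{G}$ and $w_*\in\mathcal{W}$, there exists a control function $u\in L^2(0,T;U)$ such that $\mathbb{P}_{\mathcal{G}}u=g_*$ and the solution $y$ of $$y'=Ay+Bu \ \text{ for } t\in(0,T),\qquad y(0)=y_0,$$ satisfies $y(T)=y_1$ and $\mathbb{P}_{\mathcal{W}}y=w_*$.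
   Context: $\mathbb{P}_{\mathcal{G}}$ denotes the orthogonal projection onto $\mathcal{G}$ in $L^2(0,T;U)$ and $\mathbb{P}_{\mathcal{W}}$ the orthogonal projection onto $\mathcal{W}$ in $L^2(0,T;H)$. $\mathcal{G}$ and $\mathcal{W}$ carry the norms of $L^2(0,T;U)$ and $L^2(0,T;H)$. Solutions of the evolution equations are the usual mild (semigroup) solutions, which belong to $C^0([0,T];H)$; the equation for $z$ is solved backward in time from $z(T)=z_T$. $A^*$, $B^*$ denote adjoints. *)

theory Defs
  imports "HOL-Analysis.Analysis"
begin

text \<open>
  Hilbert spaces are types of sort \<open>{real_inner, banach}\<close>; no separability is assumed.
  A complex Hilbert space is a real one for the real part of its inner product, with the same norm,
  and this changes neither adjoints of complex linear operators nor orthogonal projections onto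
  complex subspaces.
\<close>

section \<open>The space \<open>L\<^sup>2(0,T;X)\<close>\<close>

text \<open>
  Measurability is strong (Bochner) measurability: for non-separable \<open>X\<close> Borel measurability would
  not be enough. Elements of \<open>L\<^sup>2(0,T;X)\<close> are represented by functions on the real line; only
  their values almost everywhere on \<open>[0,T]\<close> matter.
\<close>

definition strongly_measurable :: "'a measure \<Rightarrow> ('a \<Rightarrow> 'x::real_normed_vector) \<Rightarrow> bool" where
  "strongly_measurable M f \<longleftrightarrow>
    (\<exists>s. (\<forall>n::nat. simple_function M (s n)) \<and> (AE t in M. (\<lambda>n. s n t) \<longlonglongrightarrow> f t))"

definition L2 :: "real \<Rightarrow> (real \<Rightarrow> 'x::real_normed_vector) set" where
  "L2 T = {f. strongly_measurable (lebesgue_on {0..T}) f \<and>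
              integrable (lebesgue_on {0..T}) (\<lambda>t. (norm (f t))\<^sup>2)}"

definition L2_norm :: "real \<Rightarrow> (real \<Rightarrow> 'x::real_normed_vector) \<Rightarrow> real" where
  "L2_norm T f = sqrt (\<integral>t. (norm (f t))\<^sup>2 \<partial>lebesgue_on {0..T})"

definition L2_inner :: "real \<Rightarrow> (real \<Rightarrow> 'x::real_inner) \<Rightarrow> (real \<Rightarrow> 'x) \<Rightarrow> real" where
  "L2_inner T f g = (\<integral>t. inner (f t) (g t) \<partial>lebesgue_on {0..T})"

text \<open>
  The closedness clause also forces \<open>V\<close> to be saturated under almost everywhere equality on
  \<open>[0,T]\<close> (constant sequences).
\<close>

definition closed_subspace_L2 :: "real \<Rightarrow> (real \<Rightarrow> 'x::real_normed_vector) set \<Rightarrow> bool" where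
  "closed_subspace_L2 T V \<longleftrightarrow>
    V \<subseteq> L2 T \<and>
    (\<lambda>t. 0) \<in> V \<and>
    (\<forall>f\<in>V. \<forall>g\<in>V. (\<lambda>t. f t + g t) \<in> V) \<and>
    (\<forall>c. \<forall>f\<in>V. (\<lambda>t. c *\<^sub>R f t) \<in> V) \<and>
    (\<forall>F. \<forall>f\<in>L2 T. (\<forall>n::nat. F n \<in> V) \<and> (\<lambda>n. L2_norm T (\<lambda>t. F n t - f t)) \<longlonglongrightarrow> 0 \<longrightarrow> f \<in> V)"

text \<open>\<open>p\<close> represents the orthogonal projection of \<open>f\<close> onto \<open>V\<close>.\<close>

definition is_L2_projection ::
    "real \<Rightarrow> (real \<Rightarrow> 'x::real_inner) set \<Rightarrow> (real \<Rightarrow> 'x) \<Rightarrow> (real \<Rightarrow> 'x) \<Rightarrow> bool" where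
  "is_L2_projection T V f p \<longleftrightarrow>
    f \<in> L2 T \<and> p \<in> V \<and> (\<forall>g\<in>V. L2_inner T (\<lambda>t. f t - p t) g = 0)"

section \<open>Semigroups, generators, mild solutions\<close>

text \<open>
  Unbounded operators are represented by their graphs. A semigroup is a function on the real line
  of which only the values at nonnegative times matter.
\<close>

definition C0_semigroup :: "(real \<Rightarrow> 'x \<Rightarrow> 'x::real_normed_vector) \<Rightarrow> bool" where
  "C0_semigroup S \<longleftrightarrow>
    (\<forall>t\<ge>0. bounded_linear (S t)) \<and>
    (\<forall>x. S 0 x = x) \<and>
    (\<forall>s\<ge>0. \<forall>t\<ge>0. \<forall>x. S (s + t) x = S s (S t x)) \<and>
    (\<forall>x. ((\<lambda>t. S t x) \<longlongrightarrow> x) (at_right 0))"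

definition generator :: "(real \<Rightarrow> 'x \<Rightarrow> 'x::real_normed_vector) \<Rightarrow> ('x \<times> 'x) set" where
  "generator S = {(x, y). ((\<lambda>t. (1 / t) *\<^sub>R (S t x - x)) \<longlongrightarrow> y) (at_right 0)}"

definition generates :: "('x \<times> 'x::real_normed_vector) set \<Rightarrow> (real \<Rightarrow> 'x \<Rightarrow> 'x) \<Rightarrow> bool" where
  "generates A S \<longleftrightarrow> C0_semigroup S \<and> A = generator S"

text \<open>The Hilbert space adjoint of a (densely defined) operator.\<close>

definition adjoint_op :: "('x \<times> 'x::real_inner) set \<Rightarrow> ('x \<times> 'x) set" where
  "adjoint_op A = {(x, y). \<forall>(v, w)\<in>A. inner w x = inner v y}"

text \<open>
  Mild solution of \<open>x' = A x + F\<close> on \<open>(0,T)\<close>, \<open>x(0) = x0\<close>: the variation of constants formula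
  \<open>x t = S t x0 + \<integral>\<^sub>0\<^sup>t S (t - s) (F s) ds\<close>, with \<open>S\<close> the semigroup generated by \<open>A\<close>. The
  Bochner integral of the library needs a second countable range, hence the gauge integral, which
  extends the Bochner integral for functions with values in an arbitrary Banach space.
\<close>

definition mild_solution ::
    "('x \<times> 'x::real_normed_vector) set \<Rightarrow> real \<Rightarrow> (real \<Rightarrow> 'x) \<Rightarrow> 'x \<Rightarrow> (real \<Rightarrow> 'x) \<Rightarrow> bool" where
  "mild_solution A T F x0 x \<longleftrightarrow>
    (\<exists>S. generates A S \<and>
         (\<forall>t\<in>{0..T}. ((\<lambda>s. S (t - s) (F s)) has_integral (x t - S t x0)) {0..t}))"

text \<open>
  Mild solution of \<open>z' + A z = f\<close> on \<open>(0,T)\<close>, \<open>z(T) = zT\<close>: reversing time,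
  \<open>x t = z (T - t)\<close> solves \<open>x' = A x - f (T - t)\<close>, \<open>x(0) = zT\<close>.
\<close>

definition backward_mild_solution ::
    "('x \<times> 'x::real_normed_vector) set \<Rightarrow> real \<Rightarrow> (real \<Rightarrow> 'x) \<Rightarrow> 'x \<Rightarrow> (real \<Rightarrow> 'x) \<Rightarrow> bool" where
  "backward_mild_solution A T f zT z \<longleftrightarrow>
    mild_solution A T (\<lambda>s. - f (T - s)) zT (\<lambda>t. z (T - t))"

end

theory Submission
  imports Defs
begin

text \<open>
  The proof is the duality argument known as the Hilbert uniqueness method. To every
  \<open>(zT, g, w, f)\<close> associate \<open>\<Lambda> (zT, g, w, f) = (B\<^sup>* z + g, f + w)\<close>, where \<open>z\<close> is the backward
  solution, and the number
  \<open>c (zT, g, w, f) = \<langle>g\<^sub>0, g\<rangle> + \<langle>w\<^sub>0, w\<rangle> + \<langle>y1, zT\<rangle> - \<langle>y0, z 0\<rangle>\<close>. The number is bounded by the norm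
  of \<open>(zT, g, w, f)\<close>, hence, by the observability inequality, by the norm of
  \<open>\<Lambda> (zT, g, w, f)\<close>. So \<open>c\<close> is a bounded linear functional of \<open>\<Lambda> (zT, g, w, f)\<close>, and the Riesz
  representation theorem gives \<open>(u, v)\<close> in \<open>L\<^sup>2(0,T;U \<times> H)\<close> with
  \<open>\<langle>u, B\<^sup>* z + g\<rangle> + \<langle>v, f + w\<rangle> = c (zT, g, w, f)\<close> for all test data (\<open>L2_riesz\<close>).

  Let \<open>y\<close> be the solution with control \<open>u\<close>. Integration by parts (\<open>duality\<close>) reads
  \<open>\<langle>u, B\<^sup>* z\<rangle> + \<langle>y, f\<rangle> = \<langle>y T, zT\<rangle> - \<langle>y0, z 0\<rangle>\<close>. Subtracting it from the preceding identity at
  \<open>g = 0\<close>, \<open>w = 0\<close> leaves \<open>\<langle>v - y, f\<rangle> = \<langle>y1 - y T, zT\<rangle>\<close> for all \<open>f\<close> and \<open>zT\<close>: the target is reached,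
  and \<open>v\<close> represents \<open>y\<close> in \<open>L\<^sup>2\<close>. Testing with \<open>g\<close> alone and with \<open>w\<close> alone gives the two projection conditions.

  Three things must be built before this argument can run. The Hilbert spaces need not be
  separable, so functions in \<open>L\<^sup>2\<close> are handled through approximating simple functions: they give
  completeness (\<open>L2_complete\<close>) and integrability in the gauge sense (\<open>L2_integrable_on\<close>).
  The adjoints of a \<open>C\<^sub>0\<close> semigroup have to be shown to form a \<open>C\<^sub>0\<close> semigroup
  (\<open>adjoint_C0_semigroup\<close>) whose generator is the adjoint operator (\<open>generator_adjoint\<close>), since
  otherwise there would be no backward solution to which the observability inequality applies.
  Finally the integration by parts is a Fubini argument for the Volterra kernel
  \<open>\<langle>S (t - s) (F s), f t\<rangle>\<close> (\<open>volterra_duality\<close>).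
\<close>

section \<open>Riesz representation by minimizing sequences\<close>

text \<open>
  The direct method for the functional \<open>a \<mapsto> ip a a - 2 * c a\<close>. The carrier, its operations and the
  semi-inner product are parameters, because the lemma serves both for subspaces of a Hilbert space
  and for linear families of functions in \<open>L\<^sup>2\<close>, where the function type is not itself an inner
  product space. The Cauchy property is expressed through the expansion of \<open>ip (a - b) (a - b)\<close>, so
  that no subtraction on the carrier is needed.
\<close>

lemma riesz_minimizing_sequence:
  fixes D :: "'a set" and add :: "'a \<Rightarrow> 'a \<Rightarrow> 'a" and scl :: "real \<Rightarrow> 'a \<Rightarrow> 'a"
    and ip :: "'a \<Rightarrow> 'a \<Rightarrow> real" and c :: "'a \<Rightarrow> real"
  assumes ne: "D \<noteq> {}"
    and add: "\<And>a b. a \<in> D \<Longrightarrow> b \<in> D \<Longrightarrow> add a b \<in> D"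
    and scl: "\<And>r a. a \<in> D \<Longrightarrow> scl r a \<in> D"
    and sym: "\<And>a b. a \<in> D \<Longrightarrow> b \<in> D \<Longrightarrow> ip a b = ip b a"
    and ip_add: "\<And>a b d. a \<in> D \<Longrightarrow> b \<in> D \<Longrightarrow> d \<in> D \<Longrightarrow> ip (add a b) d = ip a d + ip b d"
    and ip_scl: "\<And>r a d. a \<in> D \<Longrightarrow> d \<in> D \<Longrightarrow> ip (scl r a) d = r * ip a d"
    and ip_nonneg: "\<And>a. a \<in> D \<Longrightarrow> 0 \<le> ip a a"
    and c_add: "\<And>a b. a \<in> D \<Longrightarrow> b \<in> D \<Longrightarrow> c (add a b) = c a + c b"
    and c_scl: "\<And>r a. a \<in> D \<Longrightarrow> c (scl r a) = r * c a"
    and bound: "\<And>a. a \<in> D \<Longrightarrow> c a \<le> K * sqrt (ip a a)"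
  obtains x :: "nat \<Rightarrow> 'a" where "\<And>n. x n \<in> D"
    and "\<And>e. e > 0 \<Longrightarrow>
      \<exists>N. \<forall>m\<ge>N. \<forall>n\<ge>N. ip (x m) (x m) - 2 * ip (x m) (x n) + ip (x n) (x n) < e"
    and "\<And>a. a \<in> D \<Longrightarrow> (\<lambda>n. ip (x n) a) \<longlonglongrightarrow> c a"
proof -
  define \<phi> where "\<phi> a = ip a a - 2 * c a" for a
  have lower: "- K\<^sup>2 \<le> \<phi> a" if "a \<in> D" for a
  proof -
    have "0 \<le> (sqrt (ip a a) - K)\<^sup>2" by simp
    also have "\<dots> = ip a a - 2 * (K * sqrt (ip a a)) + K\<^sup>2"
      using ip_nonneg[OF that] by (simp add: power2_diff)
    also have "\<dots> \<le> \<phi> a + K\<^sup>2"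
      using bound[OF that] unfolding \<phi>_def by linarith
    finally show ?thesis by simp
  qed
  define m where "m = Inf (\<phi> ` D)"
  have bdd: "bdd_below (\<phi> ` D)"
    using lower by (meson bdd_below.I2)
  have m: "m \<le> \<phi> a" if "a \<in> D" for a
    unfolding m_def using bdd that by (intro cInf_lower) auto
  have "\<exists>a\<in>D. \<phi> a < m + 1 / (real n + 1)" for n
  proof -
    have "Inf (\<phi> ` D) < m + 1 / (real n + 1)" by (simp add: m_def)
    then show ?thesis using cInf_less_iff[of "\<phi> ` D"] bdd ne by auto
  qed
  then obtain x where x: "\<And>n. x n \<in> D" and \<phi>x: "\<And>n. \<phi> (x n) < m + 1 / (real n + 1)"
    by metis
  have quad: "\<phi> (add a (scl t b)) = \<phi> a + 2 * t * (ip a b - c b) + t\<^sup>2 * ip b b"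
    if "a \<in> D" "b \<in> D" for a b t
  proof -
    have *: "scl t b \<in> D" "add a (scl t b) \<in> D" using that add scl by auto
    have "ip (add a (scl t b)) (add a (scl t b)) = ip a (add a (scl t b)) + t * ip b (add a (scl t b))"
      using ip_add[OF \<open>a \<in> D\<close> *] ip_scl[OF \<open>b \<in> D\<close> *(2)] by simp
    also have "ip a (add a (scl t b)) = ip a a + t * ip a b"
      using sym[OF \<open>a \<in> D\<close> *(2)] ip_add[OF \<open>a \<in> D\<close> *(1) \<open>a \<in> D\<close>] ip_scl[OF \<open>b \<in> D\<close> \<open>a \<in> D\<close>, of t]
        sym[OF that] by simp
    also have "ip b (add a (scl t b)) = ip a b + t * ip b b"
      using sym[OF \<open>b \<in> D\<close> *(2)] ip_add[OF \<open>a \<in> D\<close> *(1) \<open>b \<in> D\<close>] ip_scl[OF \<open>b \<in> D\<close> \<open>b \<in> D\<close>, of t]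
      by simp
    finally show ?thesis
      unfolding \<phi>_def using c_add[OF \<open>a \<in> D\<close> *(1)] c_scl[OF \<open>b \<in> D\<close>, of t]
      by (simp add: algebra_simps power2_eq_square)
  qed
  show thesis
  proof
    show "x n \<in> D" for n by fact
  next
    fix e :: real assume "e > 0"
    obtain N :: nat where N: "4 / e < real N" using reals_Archimedean2 by blast
    have small: "1 / (real n + 1) < e / 4" if "n \<ge> N" for n
    proof -
      have "4 / e < real n + 1" using N that by linarith
      then show ?thesis using \<open>e > 0\<close> by (simp add: field_simps)
    qed
    have "ip (x i) (x i) - 2 * ip (x i) (x j) + ip (x j) (x j) < e" if "i \<ge> N" "j \<ge> N" for i j
    proof -
      \<comment> \<open>parallelogram identity: the midpoint of two almost minimizers is no better than the infimum\<close>
      have "m \<le> \<phi> (scl (1/2) (add (x i) (x j)))" using x by (intro m scl add) auto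
      also have "\<dots> = (ip (x i) (x i) + 2 * ip (x i) (x j) + ip (x j) (x j)) / 4 - (c (x i) + c (x j))"
      proof -
        let ?s = "add (x i) (x j)"
        have s: "?s \<in> D" "scl (1/2) ?s \<in> D" using x add scl by auto
        have "ip (scl (1/2) ?s) (scl (1/2) ?s) = ip ?s ?s / 4"
          using ip_scl[OF s(1,2), of "1/2"] sym[OF s(1) s(2)] ip_scl[OF s(1) s(1), of "1/2"] by simp
        moreover have "ip ?s ?s = ip (x i) (x i) + 2 * ip (x i) (x j) + ip (x j) (x j)"
          using ip_add[OF x x s(1), of i j] sym[OF x s(1)] ip_add[OF x x x, of i j] sym[OF x x, of i j]
          by simp
        ultimately show ?thesis
          unfolding \<phi>_def using c_scl[OF s(1), of "1/2"] c_add[OF x x, of i j]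
          by (simp add: field_simps)
      qed
      finally have mid: "m \<le> \<dots>" .
      have "\<phi> (x k) < m + e / 4" if "k \<ge> N" for k
        using \<phi>x[of k] small[OF that] by linarith
      from this[OF that(1)] this[OF that(2)] mid show ?thesis
        unfolding \<phi>_def by (simp add: field_simps)
    qed
    then show "\<exists>N. \<forall>m\<ge>N. \<forall>n\<ge>N. ip (x m) (x m) - 2 * ip (x m) (x n) + ip (x n) (x n) < e"
      by blast
  next
    fix a assume a: "a \<in> D"
    \<comment> \<open>vary an almost minimizer in the direction \<open>a\<close>; the summand \<open>1\<close> allows division by \<open>Q\<close>\<close>
    define Q where "Q = ip a a + 1"
    have Q: "Q > 0" using ip_nonneg[OF a] by (simp add: Q_def)
    have est: "(ip (x n) a - c a)\<^sup>2 \<le> Q / (real n + 1)" for n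
    proof -
      let ?d = "ip (x n) a - c a"
      have "m \<le> \<phi> (add (x n) (scl (- ?d / Q) a))" using x a by (intro m add scl) auto
      also have "\<dots> = \<phi> (x n) + 2 * (- ?d / Q) * ?d + (- ?d / Q)\<^sup>2 * ip a a"
        by (rule quad[OF x a])
      also have "(- ?d / Q)\<^sup>2 * ip a a \<le> (- ?d / Q)\<^sup>2 * Q"
        by (intro mult_left_mono) (auto simp: Q_def)
      finally have "m \<le> \<phi> (x n) + 2 * (- ?d / Q) * ?d + (- ?d / Q)\<^sup>2 * Q" by simp
      moreover have "(- ?d / Q)\<^sup>2 * Q = ?d\<^sup>2 / Q" and "2 * (- ?d / Q) * ?d = - (2 * (?d\<^sup>2 / Q))"
        using Q by (simp_all add: power2_eq_square field_simps)
      ultimately have "m \<le> \<phi> (x n) - ?d\<^sup>2 / Q" by linarith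
      then have "?d\<^sup>2 / Q \<le> 1 / (real n + 1)" using \<phi>x[of n] by linarith
      then show ?thesis using Q by (simp add: field_simps)
    qed
    have "(\<lambda>n. Q * (1 / (real n + 1))) \<longlonglongrightarrow> Q * 0"
      using LIMSEQ_inverse_real_of_nat by (intro tendsto_mult tendsto_const) (simp add: inverse_eq_divide add.commute)
    then have "(\<lambda>n. Q / (real n + 1)) \<longlonglongrightarrow> 0" by simp
    then have "(\<lambda>n. (ip (x n) a - c a)\<^sup>2) \<longlonglongrightarrow> 0"
      by (rule tendsto_sandwich[OF _ _ tendsto_const, rotated 2])
        (use est in \<open>auto intro!: always_eventually\<close>)
    then have "(\<lambda>n. \<bar>ip (x n) a - c a\<bar>) \<longlonglongrightarrow> 0"
      using tendsto_real_sqrt[of "\<lambda>n. (ip (x n) a - c a)\<^sup>2" 0 sequentially] by simp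
    then show "(\<lambda>n. ip (x n) a) \<longlonglongrightarrow> c a"
      using LIM_zero_cancel tendsto_rabs_zero_iff by blast
  qed
qed

text \<open>
  For \<open>D = UNIV\<close> this is the Riesz representation theorem; for a proper subspace and
  \<open>c = inner y\<close> the vector \<open>h\<close> is the orthogonal projection of \<open>y\<close> onto the closure.
\<close>

lemma riesz_on_subspace:
  fixes D :: "'h::{real_inner, banach} set" and c :: "'h \<Rightarrow> real"
  assumes D: "subspace D"
    and c_add: "\<And>a b. a \<in> D \<Longrightarrow> b \<in> D \<Longrightarrow> c (a + b) = c a + c b"
    and c_scl: "\<And>r a. a \<in> D \<Longrightarrow> c (r *\<^sub>R a) = r * c a"
    and bound: "\<And>a. a \<in> D \<Longrightarrow> c a \<le> K * norm a"
  obtains h where "h \<in> closure D" and "\<And>a. a \<in> D \<Longrightarrow> inner h a = c a"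
proof -
  obtain x :: "nat \<Rightarrow> 'h" where x: "\<And>n. x n \<in> D"
    and cau: "\<And>e. e > 0 \<Longrightarrow> \<exists>N. \<forall>m\<ge>N. \<forall>n\<ge>N.
        inner (x m) (x m) - 2 * inner (x m) (x n) + inner (x n) (x n) < e"
    and lim: "\<And>a. a \<in> D \<Longrightarrow> (\<lambda>n. inner (x n) a) \<longlonglongrightarrow> c a"
  proof (rule riesz_minimizing_sequence[of D "(+)" "(*\<^sub>R)" inner c K])
    show "D \<noteq> {}" using subspace_0[OF D] by blast
  qed (use D c_add c_scl bound in
    \<open>auto simp: subspace_add subspace_scale inner_add_left norm_eq_sqrt_inner[symmetric]
      intro: inner_commute\<close>)
  have "Cauchy x"
  proof (rule metric_CauchyI)
    fix e :: real assume "e > 0"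
    then obtain N where N: "\<forall>m\<ge>N. \<forall>n\<ge>N.
        inner (x m) (x m) - 2 * inner (x m) (x n) + inner (x n) (x n) < e\<^sup>2"
      using cau[of "e\<^sup>2"] by auto
    have "dist (x m) (x n) < e" if "m \<ge> N" "n \<ge> N" for m n
    proof -
      have "(norm (x m - x n))\<^sup>2 < e\<^sup>2"
        using N that by (simp add: power2_norm_eq_inner inner_diff inner_commute algebra_simps)
      then show ?thesis using \<open>e > 0\<close> by (simp add: dist_norm power_less_imp_less_base)
    qed
    then show "\<exists>M. \<forall>m\<ge>M. \<forall>n\<ge>M. dist (x m) (x n) < e" by blast
  qed
  then obtain h where h: "x \<longlonglongrightarrow> h" using Cauchy_convergent convergent_def by blast
  show thesis
  proof
    show "h \<in> closure D" using closure_sequential x h by blast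
    fix a assume "a \<in> D"
    have "(\<lambda>n. inner (x n) a) \<longlonglongrightarrow> inner h a" by (intro tendsto_intros h)
    then show "inner h a = c a" using lim[OF \<open>a \<in> D\<close>] LIMSEQ_unique by blast
  qed
qed

text \<open>
  The constant \<open>adjoint\<close> is a choice among all functions with this property; the Riesz theorem
  provides one on every Hilbert space.
\<close>

lemma inner_adjoint:
  fixes f :: "'a::{real_inner, banach} \<Rightarrow> 'b::real_inner"
  assumes "bounded_linear f"
  shows "inner (f x) y = inner x (adjoint f y)"
proof -
  interpret bounded_linear f by fact
  have "\<exists>h. \<forall>x. inner (f x) y = inner x h" for y
  proof -
    obtain K where K: "\<And>x. norm (f x) \<le> norm x * K" using bounded by blast
    have "inner (f a) y \<le> (K * norm y) * norm a" for a
    proof -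
      have "inner (f a) y \<le> norm (f a) * norm y" by (rule norm_cauchy_schwarz)
      also have "\<dots> \<le> (norm a * K) * norm y" by (intro mult_right_mono K) auto
      finally show ?thesis by (simp add: mult_ac)
    qed
    then obtain h where "\<And>a. inner h a = inner (f a) y"
      using riesz_on_subspace[of UNIV "\<lambda>x. inner (f x) y" "K * norm y"]
      by (auto simp: add scale inner_add_left)
    then show ?thesis by (metis inner_commute)
  qed
  then obtain g where "\<forall>x y. inner (f x) y = inner x (g y)" by metis
  then show ?thesis
    unfolding adjoint_def by (rule someI2[where Q = "\<lambda>f'. inner (f x) y = inner x (f' y)"]) blast
qed

lemma norm_adjoint_le:
  fixes f :: "'a::{real_inner, banach} \<Rightarrow> 'b::real_inner"
  assumes f: "bounded_linear f" and K: "\<And>x. norm (f x) \<le> K * norm x" and "0 \<le> K"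
  shows "norm (adjoint f y) \<le> K * norm y"
proof (cases "adjoint f y = 0")
  case False
  have "norm (adjoint f y) * norm (adjoint f y) = inner (f (adjoint f y)) y"
    by (simp add: inner_adjoint[OF f] norm_eq_sqrt_inner)
  also have "\<dots> \<le> norm (f (adjoint f y)) * norm y" by (rule norm_cauchy_schwarz)
  also have "\<dots> \<le> (K * norm (adjoint f y)) * norm y" by (intro mult_right_mono K) auto
  finally have "norm (adjoint f y) * norm (adjoint f y) \<le> norm (adjoint f y) * (K * norm y)"
    by (simp add: mult_ac)
  then show ?thesis using False by simp
qed (use \<open>0 \<le> K\<close> in simp)

lemma bounded_linear_adjoint:
  fixes f :: "'a::{real_inner, banach} \<Rightarrow> 'b::real_inner"
  assumes f: "bounded_linear f"
  shows "bounded_linear (adjoint f)"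
proof -
  obtain K where "0 < K" and K: "\<And>x. norm (f x) \<le> norm x * K"
    using bounded_linear.pos_bounded[OF f] by blast
  show ?thesis
  proof (rule bounded_linear_intro[where K = K])
    fix x y and r :: real
    have "inner z (adjoint f (x + y)) = inner z (adjoint f x + adjoint f y)" for z
      by (simp add: inner_add_right inner_adjoint[OF f, symmetric])
    then show "adjoint f (x + y) = adjoint f x + adjoint f y"
      using vector_eq_rdot by (metis inner_commute)
    have "inner z (adjoint f (r *\<^sub>R x)) = inner z (r *\<^sub>R adjoint f x)" for z
      by (simp add: inner_adjoint[OF f, symmetric])
    then show "adjoint f (r *\<^sub>R x) = r *\<^sub>R adjoint f x"
      using vector_eq_rdot by (metis inner_commute)
    show "norm (adjoint f x) \<le> norm x * K"
      using norm_adjoint_le[OF f, of K] K \<open>0 < K\<close> by (simp add: mult.commute)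
  qed
qed

lemma closed_subspace_eq_UNIV:
  fixes Y :: "'h::{real_inner, banach} set"
  assumes "subspace Y" "closed Y" and "\<And>x. (\<And>y. y \<in> Y \<Longrightarrow> inner x y = 0) \<Longrightarrow> x = 0"
  shows "Y = UNIV"
proof -
  have "y \<in> Y" for y
  proof -
    obtain h where h: "h \<in> closure Y" "\<And>a. a \<in> Y \<Longrightarrow> inner h a = inner y a"
      using riesz_on_subspace[OF assms(1), of "\<lambda>a. inner y a" "norm y"]
      by (auto simp: inner_add_right norm_cauchy_schwarz)
    have "y - h = 0" by (rule assms(3)) (simp add: inner_diff_left h(2))
    then show ?thesis using h(1) \<open>closed Y\<close> by simp
  qed
  then show ?thesis by blast
qed

section \<open>Strong measurability\<close>

text \<open>
  Convergence at every point is what makes composed functions of several variables jointly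
  measurable; it is obtained by putting everything to \<open>0\<close> on the exceptional null set.
\<close>

lemma strongly_measurable_everywhere:
  fixes f :: "'a \<Rightarrow> 'x::real_normed_vector"
  assumes "strongly_measurable M f"
  obtains s f' where "\<And>n::nat. simple_function M (s n)"
    and "\<And>t. t \<in> space M \<Longrightarrow> (\<lambda>n. s n t) \<longlonglongrightarrow> f' t" and "AE t in M. f' t = f t"
proof -
  obtain s where s: "\<And>n::nat. simple_function M (s n)" and lim: "AE t in M. (\<lambda>n. s n t) \<longlonglongrightarrow> f t"
    using assms unfolding strongly_measurable_def by blast
  obtain N where N: "{t \<in> space M. \<not> (\<lambda>n. s n t) \<longlonglongrightarrow> f t} \<subseteq> N" "N \<in> null_sets M"
    using lim by (auto simp: eventually_ae_filter)
  show thesis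
  proof
    have "N \<inter> space M \<in> sets M" using N(2) by (metis null_setsD2 sets.Int sets.top)
    then show "simple_function M (\<lambda>t. if t \<in> N then 0 else s n t)" for n
      using simple_function_If_set[OF _ s, of "\<lambda>_. 0" N n] by simp
    show "(\<lambda>n. if t \<in> N then 0 else s n t) \<longlonglongrightarrow> (if t \<in> N then 0 else f t)" if "t \<in> space M" for t
      using N(1) that by auto
    show "AE t in M. (if t \<in> N then 0 else f t) = f t"
      using AE_not_in[OF N(2)] by eventually_elim simp
  qed
qed

lemma strongly_measurable_simple: "simple_function M s \<Longrightarrow> strongly_measurable M s"
  unfolding strongly_measurable_def by (intro exI[of _ "\<lambda>_. s"]) simp

lemma strongly_measurable_compose2:
  assumes "strongly_measurable M f" and "strongly_measurable M g"
    and h: "\<And>X Y x y. X \<longlonglongrightarrow> x \<Longrightarrow> Y \<longlonglongrightarrow> y \<Longrightarrow> (\<lambda>n. h (X n) (Y n)) \<longlonglongrightarrow> h x y"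
  shows "strongly_measurable M (\<lambda>t. h (f t) (g t))"
proof -
  obtain s r where s: "\<And>n::nat. simple_function M (s n)" "AE t in M. (\<lambda>n. s n t) \<longlonglongrightarrow> f t"
    and r: "\<And>n::nat. simple_function M (r n)" "AE t in M. (\<lambda>n. r n t) \<longlonglongrightarrow> g t"
    using assms(1,2) unfolding strongly_measurable_def by blast
  have "AE t in M. (\<lambda>n. h (s n t) (r n t)) \<longlonglongrightarrow> h (f t) (g t)"
    using s(2) r(2) by eventually_elim (rule h)
  then show ?thesis
    unfolding strongly_measurable_def using s(1) r(1)
    by (intro exI[of _ "\<lambda>n t. h (s n t) (r n t)"]) (auto intro: simple_function_compose2)
qed

lemma strongly_measurable_compose1:
  assumes "strongly_measurable M f" and "\<And>X x. X \<longlonglongrightarrow> x \<Longrightarrow> (\<lambda>n. h (X n)) \<longlonglongrightarrow> h x"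
  shows "strongly_measurable M (\<lambda>t. h (f t))"
  by (rule strongly_measurable_compose2[OF assms(1,1), where h = "\<lambda>x _. h x"]) (rule assms(2))

text \<open>
  This is where completeness of the Lebesgue measure enters.
\<close>

lemma borel_measurable_lebesgue_on_AE:
  fixes f g :: "real \<Rightarrow> real"
  assumes f: "f \<in> borel_measurable (lebesgue_on S)" and S: "S \<in> sets lebesgue"
    and ae: "AE x in lebesgue_on S. f x = g x"
  shows "g \<in> borel_measurable (lebesgue_on S)"
proof -
  have "AE x in lebesgue. x \<in> S \<longrightarrow> f x = g x"
    using ae S by (simp add: AE_restrict_space_iff)
  then have "AE x in lebesgue. (if x \<in> S then f x else 0) = (if x \<in> S then g x else 0)"
    by eventually_elim auto
  from borel_measurable_AE[OF _ this] show ?thesis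
    using f by (simp add: borel_measurable_if[OF S])
qed

lemma strongly_measurable_imp_borel_measurable:
  fixes f :: "real \<Rightarrow> real"
  assumes f: "strongly_measurable (lebesgue_on S) f" and S: "S \<in> sets lebesgue"
  shows "f \<in> borel_measurable (lebesgue_on S)"
proof -
  obtain s f' where s: "\<And>n::nat. simple_function (lebesgue_on S) (s n)"
    and lim: "\<And>t. t \<in> space (lebesgue_on S) \<Longrightarrow> (\<lambda>n. s n t) \<longlonglongrightarrow> f' t"
    and ae: "AE t in lebesgue_on S. f' t = f t"
    by (rule strongly_measurable_everywhere[OF f]) (rule that)
  have "f' \<in> borel_measurable (lebesgue_on S)"
    by (rule borel_measurable_LIMSEQ_real[OF lim borel_measurable_simple_function[OF s]])
  then show ?thesis by (rule borel_measurable_lebesgue_on_AE[OF _ S ae])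
qed

text \<open>
  A Caratheodory condition in which continuity in \<open>s\<close> is only required from the right. The proof
  replaces \<open>s\<close> by the next larger point of a finite grid and \<open>F\<close> by simple functions; the composed
  approximations again take finitely many values, so that no diagonal argument is needed.
\<close>

lemma strongly_measurable_caratheodory:
  fixes \<phi> :: "real \<Rightarrow> 'x::real_normed_vector \<Rightarrow> 'y::real_normed_vector"
  assumes F: "strongly_measurable (lebesgue_on {0..T}) F"
    and \<phi>: "\<And>s x d X. s \<in> {0..T} \<Longrightarrow> (\<And>n::nat. d n \<in> {s..T}) \<Longrightarrow> d \<longlonglongrightarrow> s \<Longrightarrow> X \<longlonglongrightarrow> x \<Longrightarrow>
      (\<lambda>n. \<phi> (d n) (X n)) \<longlonglongrightarrow> \<phi> s x"
  shows "strongly_measurable (lebesgue_on {0..T}) (\<lambda>s. \<phi> s (F s))"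
proof -
  obtain X where X: "\<And>n::nat. simple_function (lebesgue_on {0..T}) (X n)"
    and lim: "AE t in lebesgue_on {0..T}. (\<lambda>n. X n t) \<longlonglongrightarrow> F t"
    using F unfolding strongly_measurable_def by blast
  define d :: "nat \<Rightarrow> real \<Rightarrow> real"
    where "d n s = min T ((of_int \<lfloor>(real n + 1) * s\<rfloor> + 1) / (real n + 1))" for n s
  have d_simple: "simple_function (lebesgue_on {0..T}) (d n)" for n
  proof (rule simple_function_borel_measurable)
    have "d n \<in> borel_measurable borel" unfolding d_def by measurable
    then show "d n \<in> borel_measurable (lebesgue_on {0..T})"
      by (simp add: measurable_completion measurable_restrict_space1)
    have "d n ` {0..T} \<subseteq> (\<lambda>k. min T ((of_int k + 1) / (real n + 1))) ` {0..\<lfloor>(real n + 1) * T\<rfloor>}"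
      by (auto simp: d_def intro!: imageI floor_mono mult_left_mono)
    then show "finite (d n ` space (lebesgue_on {0..T}))"
      by (simp add: finite_subset)
  qed
  have d_in: "d n s \<in> {s..T}" and d_le: "d n s \<le> s + 1 / (real n + 1)" if "s \<in> {0..T}" for n s
  proof -
    have "s \<le> (of_int \<lfloor>(real n + 1) * s\<rfloor> + 1) / (real n + 1)"
      by (simp add: pos_le_divide_eq mult.commute)
    then show "d n s \<in> {s..T}" using that by (auto simp: d_def)
    have "d n s \<le> (of_int \<lfloor>(real n + 1) * s\<rfloor> + 1) / (real n + 1)" by (simp add: d_def)
    also have "\<dots> \<le> ((real n + 1) * s + 1) / (real n + 1)"
      by (intro divide_right_mono) auto
    also have "\<dots> = s + 1 / (real n + 1)" by (simp add: field_simps)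
    finally show "d n s \<le> s + 1 / (real n + 1)" .
  qed
  have d_lim: "(\<lambda>n. d n s) \<longlonglongrightarrow> s" if "s \<in> {0..T}" for s
  proof (rule tendsto_sandwich[where f = "\<lambda>_. s" and h = "\<lambda>n. s + 1 / (real n + 1)"])
    have "(\<lambda>n. s + 1 / (real n + 1)) \<longlonglongrightarrow> s + 0"
      using LIMSEQ_inverse_real_of_nat
      by (intro tendsto_add tendsto_const) (simp add: inverse_eq_divide add.commute)
    then show "(\<lambda>n. s + 1 / (real n + 1)) \<longlonglongrightarrow> s" by simp
  qed (use d_in[OF that] d_le[OF that] in auto)
  have "AE t in lebesgue_on {0..T}. (\<lambda>n. \<phi> (d n t) (X n t)) \<longlonglongrightarrow> \<phi> t (F t)"
    using lim AE_space
  proof eventually_elim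
    case (elim t)
    then have "t \<in> {0..T}" by simp
    then show ?case using d_in d_lim elim(1) by (intro \<phi>) auto
  qed
  then show ?thesis
    unfolding strongly_measurable_def using simple_function_compose2[OF d_simple X, of \<phi>]
    by (intro exI[of _ "\<lambda>n t. \<phi> (d n t) (X n t)"]) auto
qed

section \<open>The space \<open>L\<^sup>2\<close> as a semi-inner product space\<close>

lemma L2_measurable: "f \<in> L2 T \<Longrightarrow> strongly_measurable (lebesgue_on {0..T}) f"
  and L2_square_integrable: "f \<in> L2 T \<Longrightarrow> integrable (lebesgue_on {0..T}) (\<lambda>t. (norm (f t))\<^sup>2)"
  by (auto simp: L2_def)

lemma measurable_lebesgue_on_interval:
  fixes f :: "real \<Rightarrow> real"
  assumes "strongly_measurable (lebesgue_on {0..T}) f"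
  shows "f \<in> borel_measurable (lebesgue_on {0..T})"
  using assms by (rule strongly_measurable_imp_borel_measurable) simp

lemma measurable_norm_strongly:
  fixes T :: real
  shows "strongly_measurable (lebesgue_on {0..T}) f \<Longrightarrow> (\<lambda>t. norm (f t)) \<in> borel_measurable (lebesgue_on {0..T})"
  by (intro measurable_lebesgue_on_interval strongly_measurable_compose1[where h = norm] tendsto_norm)

text \<open>
  The common reason for the closure properties of \<open>L\<^sup>2\<close> under pointwise operations: measurability and
  a pointwise bound by two members suffice.
\<close>

lemma L2_dominated:
  fixes h :: "real \<Rightarrow> 'z::real_normed_vector"
  assumes h: "strongly_measurable (lebesgue_on {0..T}) h" and "f \<in> L2 T" "g \<in> L2 T"
    and le: "\<And>t. t \<in> {0..T} \<Longrightarrow> norm (h t) \<le> a * norm (f t) + b * norm (g t)"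
  shows "h \<in> L2 T"
proof -
  have "integrable (lebesgue_on {0..T}) (\<lambda>t. (norm (h t))\<^sup>2)"
  proof (rule Bochner_Integration.integrable_bound)
    show "integrable (lebesgue_on {0..T}) (\<lambda>t. 2 * a\<^sup>2 * (norm (f t))\<^sup>2 + 2 * b\<^sup>2 * (norm (g t))\<^sup>2)"
      using assms(2,3)[THEN L2_square_integrable] by simp
    show "(\<lambda>t. (norm (h t))\<^sup>2) \<in> borel_measurable (lebesgue_on {0..T})"
      using measurable_norm_strongly[OF h] by measurable
    have "(norm (h t))\<^sup>2 \<le> 2 * a\<^sup>2 * (norm (f t))\<^sup>2 + 2 * b\<^sup>2 * (norm (g t))\<^sup>2" if "t \<in> {0..T}" for t
    proof -
      have "(norm (h t))\<^sup>2 \<le> (a * norm (f t) + b * norm (g t))\<^sup>2"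
        using le[OF that] by (intro power_mono) auto
      also have "\<dots> \<le> 2 * (a * norm (f t))\<^sup>2 + 2 * (b * norm (g t))\<^sup>2"
        using sum_squares_bound[of "a * norm (f t)" "b * norm (g t)"] by (simp add: power2_sum)
      finally show ?thesis by (simp add: power_mult_distrib)
    qed
    then show "AE t in lebesgue_on {0..T}. norm ((norm (h t))\<^sup>2)
        \<le> norm (2 * a\<^sup>2 * (norm (f t))\<^sup>2 + 2 * b\<^sup>2 * (norm (g t))\<^sup>2)"
      by (intro AE_I2) auto
  qed
  then show ?thesis using h by (simp add: L2_def)
qed

lemma L2_add: "f \<in> L2 T \<Longrightarrow> g \<in> L2 T \<Longrightarrow> (\<lambda>t. f t + g t) \<in> L2 T"
  by (rule L2_dominated[of T _ f g 1 1])
    (auto intro!: strongly_measurable_compose2[of _ _ _ "(+)"] tendsto_add norm_triangle_ineq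
      dest: L2_measurable)

lemma L2_diff: "f \<in> L2 T \<Longrightarrow> g \<in> L2 T \<Longrightarrow> (\<lambda>t. f t - g t) \<in> L2 T"
  by (rule L2_dominated[of T _ f g 1 1])
    (auto intro!: strongly_measurable_compose2[of _ _ _ "(-)"] tendsto_diff norm_triangle_ineq4
      dest: L2_measurable)

lemma L2_bounded_linear:
  assumes B: "bounded_linear B" and f: "f \<in> L2 T"
  shows "(\<lambda>t. B (f t)) \<in> L2 T"
proof -
  obtain K where K: "\<And>x. norm (B x) \<le> norm x * K" using bounded_linear.bounded[OF B] by blast
  show ?thesis
  proof (rule L2_dominated[OF _ f f, of _ K 0])
    show "strongly_measurable (lebesgue_on {0..T}) (\<lambda>t. B (f t))"
      using L2_measurable[OF f] bounded_linear.tendsto[OF B]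
      by (rule strongly_measurable_compose1[where h = B])
  qed (use K in \<open>simp add: mult.commute\<close>)
qed

lemma L2_scaleR: "f \<in> L2 T \<Longrightarrow> (\<lambda>t. r *\<^sub>R f t) \<in> L2 T"
  using L2_bounded_linear[OF bounded_linear_scaleR_right] .

lemma L2_minus: "f \<in> L2 T \<Longrightarrow> (\<lambda>t. - f t) \<in> L2 T"
  using L2_bounded_linear[OF bounded_linear_minus[OF bounded_linear_ident]] .

lemma finite_measure_interval: "finite_measure (lebesgue_on {0..T::real})"
  by (rule finite_measure_lebesgue_on) simp

lemma L2_const: "(\<lambda>t. c) \<in> L2 T"
  by (simp add: L2_def strongly_measurable_simple finite_measure.integrable_const[OF finite_measure_interval])

lemma L2_bounded:
  assumes "strongly_measurable (lebesgue_on {0..T}) h" and "\<And>t. t \<in> {0..T} \<Longrightarrow> norm (h t) \<le> K"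
  shows "h \<in> L2 T"
  using assms(2) by (intro L2_dominated[OF assms(1) L2_const[of "1::real"] L2_const[of "1::real"], of K 0]) auto

lemma L2_norm_fun: "f \<in> L2 T \<Longrightarrow> (\<lambda>t. norm (f t)) \<in> L2 T"
  by (rule L2_dominated[of T _ f f 1 0])
    (auto intro!: strongly_measurable_compose1[of _ _ norm] tendsto_norm dest: L2_measurable)

lemma L2_Pair: "f \<in> L2 T \<Longrightarrow> g \<in> L2 T \<Longrightarrow> (\<lambda>t. (f t, g t)) \<in> L2 T"
  by (rule L2_dominated[of T _ f g 1 1])
    (auto intro!: strongly_measurable_compose2[of _ _ _ Pair] tendsto_Pair norm_Pair_le
      dest: L2_measurable)

lemma integrable_L2_inner:
  fixes f g :: "real \<Rightarrow> 'x::real_inner"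
  assumes "f \<in> L2 T" "g \<in> L2 T"
  shows "integrable (lebesgue_on {0..T}) (\<lambda>t. inner (f t) (g t))"
proof (rule Bochner_Integration.integrable_bound)
  show "integrable (lebesgue_on {0..T}) (\<lambda>t. (norm (f t))\<^sup>2 + (norm (g t))\<^sup>2)"
    using assms[THEN L2_square_integrable] by simp
  show "(\<lambda>t. inner (f t) (g t)) \<in> borel_measurable (lebesgue_on {0..T})"
    using assms by (intro measurable_lebesgue_on_interval strongly_measurable_compose2[of _ _ _ inner])
      (auto intro: L2_measurable tendsto_inner)
  have "norm (inner x y) \<le> norm ((norm x)\<^sup>2 + (norm y)\<^sup>2)" for x y :: 'x
    using Cauchy_Schwarz_ineq2[of x y] sum_squares_bound[of "norm x" "norm y"]
      mult_nonneg_nonneg[OF norm_ge_zero norm_ge_zero, of x y] by simp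
  then show "AE t in lebesgue_on {0..T}. norm (inner (f t) (g t)) \<le> norm ((norm (f t))\<^sup>2 + (norm (g t))\<^sup>2)"
    by simp
qed

lemma integrable_L2_norm_mult:
  "f \<in> L2 T \<Longrightarrow> g \<in> L2 T \<Longrightarrow> integrable (lebesgue_on {0..T}) (\<lambda>t. norm (f t) * norm (g t))"
  using integrable_L2_inner[OF L2_norm_fun L2_norm_fun] by (simp add: inner_real_def)

lemma integrable_L2_norm: "f \<in> L2 T \<Longrightarrow> integrable (lebesgue_on {0..T}) (\<lambda>t. norm (f t))"
  using integrable_L2_norm_mult[OF _ L2_const[of "1::real"]] by simp

lemma L2_norm_nonneg: "0 \<le> L2_norm T f"
  unfolding L2_norm_def by (intro real_sqrt_ge_zero integral_nonneg_AE) auto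

lemma L2_norm_power2: "(L2_norm T f)\<^sup>2 = (\<integral>t. (norm (f t))\<^sup>2 \<partial>lebesgue_on {0..T})"
  unfolding L2_norm_def by (intro real_sqrt_pow2 integral_nonneg_AE) auto

lemma L2_inner_self: "L2_inner T f f = (L2_norm T f)\<^sup>2"
  by (simp add: L2_inner_def L2_norm_power2 power2_norm_eq_inner)

lemma L2_inner_commute: "L2_inner T f g = L2_inner T g f"
  by (simp add: L2_inner_def inner_commute)

lemma L2_inner_add_left:
  "f \<in> L2 T \<Longrightarrow> g \<in> L2 T \<Longrightarrow> h \<in> L2 T \<Longrightarrow>
    L2_inner T (\<lambda>t. f t + g t) h = L2_inner T f h + L2_inner T g h"
  by (simp add: L2_inner_def inner_add_left integrable_L2_inner)

lemma L2_inner_diff_left: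
  "f \<in> L2 T \<Longrightarrow> g \<in> L2 T \<Longrightarrow> h \<in> L2 T \<Longrightarrow>
    L2_inner T (\<lambda>t. f t - g t) h = L2_inner T f h - L2_inner T g h"
  by (simp add: L2_inner_def inner_diff_left integrable_L2_inner)

lemma L2_inner_add_right:
  "f \<in> L2 T \<Longrightarrow> g \<in> L2 T \<Longrightarrow> h \<in> L2 T \<Longrightarrow>
    L2_inner T h (\<lambda>t. f t + g t) = L2_inner T h f + L2_inner T h g"
  by (simp add: L2_inner_commute[of T h] L2_inner_add_left)

lemma L2_inner_scaleR_left: "L2_inner T (\<lambda>t. r *\<^sub>R f t) h = r * L2_inner T f h"
  by (simp add: L2_inner_def)

lemma L2_inner_scaleR_right: "L2_inner T h (\<lambda>t. r *\<^sub>R f t) = r * L2_inner T h f"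
  by (simp add: L2_inner_def)

lemma L2_norm_fun_eq: "L2_norm T (\<lambda>t. norm (f t)) = L2_norm T f"
  by (simp add: L2_norm_def)

lemma L2_inner_le:
  fixes f g :: "real \<Rightarrow> 'x::real_inner"
  assumes f: "f \<in> L2 T" and g: "g \<in> L2 T"
  shows "\<bar>L2_inner T f g\<bar> \<le> L2_norm T f * L2_norm T g"
proof -
  let ?a = "(L2_norm T f)\<^sup>2" and ?b = "L2_inner T f g" and ?c = "(L2_norm T g)\<^sup>2"
  have quad: "0 \<le> ?a + 2 * r * ?b + r\<^sup>2 * ?c" for r
  proof -
    have "0 \<le> L2_inner T (\<lambda>t. f t + r *\<^sub>R g t) (\<lambda>t. f t + r *\<^sub>R g t)"
      by (simp add: L2_inner_self)
    also have "\<dots> = ?a + 2 * r * ?b + r\<^sup>2 * ?c"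
      unfolding L2_inner_self[symmetric] using f g L2_scaleR[OF g, of r]
      by (simp add: L2_inner_add_left L2_inner_add_right L2_add L2_inner_scaleR_left
          L2_inner_scaleR_right L2_inner_commute[of T g f] power2_eq_square algebra_simps)
    finally show ?thesis .
  qed
  have "?b\<^sup>2 \<le> ?a * ?c"
  proof (cases "?c = 0")
    case True
    \<comment> \<open>the form is only semidefinite; if \<open>g\<close> is null, the polynomial is affine in \<open>r\<close>\<close>
    have "?b = 0"
    proof (rule ccontr)
      assume "?b \<noteq> 0"
      then show False using quad[of "- (?a + 1) / (2 * ?b)"] True by (simp add: field_simps)
    qed
    then show ?thesis using True by simp
  next
    case False
    then have "?c > 0" by (simp add: less_le)
    have "b\<^sup>2 \<le> a * k" if "0 \<le> a + 2 * (- b / k) * b + (- b / k)\<^sup>2 * k" "k > 0" for a b k :: real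
      using that by (simp add: field_simps power2_eq_square)
    then show ?thesis using quad[of "- ?b / ?c"] \<open>?c > 0\<close> by blast
  qed
  then have "\<bar>?b\<bar>\<^sup>2 \<le> (L2_norm T f * L2_norm T g)\<^sup>2" by (simp add: power_mult_distrib)
  then show ?thesis by (rule power2_le_imp_le) (simp add: L2_norm_nonneg)
qed

lemma L2_norm_add_le:
  fixes f g :: "real \<Rightarrow> 'x::real_inner"
  assumes f: "f \<in> L2 T" and g: "g \<in> L2 T"
  shows "L2_norm T (\<lambda>t. f t + g t) \<le> L2_norm T f + L2_norm T g"
proof (rule power2_le_imp_le)
  have "(L2_norm T (\<lambda>t. f t + g t))\<^sup>2 = (L2_norm T f)\<^sup>2 + 2 * L2_inner T f g + (L2_norm T g)\<^sup>2"
    unfolding L2_inner_self[symmetric] using f g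
    by (simp add: L2_inner_add_left L2_inner_add_right L2_add L2_inner_commute[of T g f])
  also have "\<dots> \<le> (L2_norm T f + L2_norm T g)\<^sup>2"
    using L2_inner_le[OF f g] by (simp add: power2_sum)
  finally show "(L2_norm T (\<lambda>t. f t + g t))\<^sup>2 \<le> (L2_norm T f + L2_norm T g)\<^sup>2" .
qed (simp add: L2_norm_nonneg)

lemma L2_norm_minus_commute: "L2_norm T (\<lambda>t. f t - g t) = L2_norm T (\<lambda>t. g t - f t)"
  by (simp add: L2_norm_def norm_minus_commute)

lemma L2_norm_triangle_diff:
  fixes f g h :: "real \<Rightarrow> 'x::real_inner"
  assumes "f \<in> L2 T" "g \<in> L2 T" "h \<in> L2 T"
  shows "L2_norm T (\<lambda>t. f t - h t) \<le> L2_norm T (\<lambda>t. f t - g t) + L2_norm T (\<lambda>t. g t - h t)"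
  using L2_norm_add_le[OF L2_diff[OF assms(1,2)] L2_diff[OF assms(2,3)]] by simp

lemma L1_le_L2:
  fixes f :: "real \<Rightarrow> 'x::real_normed_vector"
  assumes "T \<ge> 0" and f: "f \<in> L2 T"
  shows "(\<integral>t. norm (f t) \<partial>lebesgue_on {0..T}) \<le> sqrt T * L2_norm T f"
proof -
  have "L2_norm T (\<lambda>_. 1::real) = sqrt T"
    using \<open>T \<ge> 0\<close> by (simp add: L2_norm_def measure_restrict_space)
  then show ?thesis
    using L2_inner_le[OF L2_norm_fun[OF f] L2_const[of "1::real"]]
    by (simp add: L2_inner_def L2_norm_fun_eq mult.commute)
qed

section \<open>Completeness of \<open>L\<^sup>2\<close> and the gauge integral\<close>

lemma L2_AE:
  assumes f: "strongly_measurable (lebesgue_on {0..T}) f" and g: "g \<in> L2 T"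
    and ae: "AE t in lebesgue_on {0..T}. f t = g t"
  shows "f \<in> L2 T" and "L2_norm T f = L2_norm T g"
proof -
  have m: "(\<lambda>t. (norm (f t))\<^sup>2) \<in> borel_measurable (lebesgue_on {0..T})"
    "(\<lambda>t. (norm (g t))\<^sup>2) \<in> borel_measurable (lebesgue_on {0..T})"
    using measurable_norm_strongly[OF f] measurable_norm_strongly[OF L2_measurable[OF g]] by measurable
  have eq: "AE t in lebesgue_on {0..T}. (norm (f t))\<^sup>2 = (norm (g t))\<^sup>2"
    using ae by eventually_elim simp
  show "f \<in> L2 T"
    using f integrable_cong_AE[OF m eq] L2_square_integrable[OF g] by (simp add: L2_def)
  show "L2_norm T f = L2_norm T g"
    unfolding L2_norm_def using integral_cong_AE[OF m eq] by simp
qed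

text \<open>
  Fatou's lemma, which yields membership in \<open>L\<^sup>2\<close> together with the norm bound.
\<close>

lemma L2_fatou:
  fixes \<sigma> :: "nat \<Rightarrow> real \<Rightarrow> 'x::real_normed_vector"
  assumes \<sigma>: "\<And>n. \<sigma> n \<in> L2 T" and h: "strongly_measurable (lebesgue_on {0..T}) h"
    and lim: "AE t in lebesgue_on {0..T}. (\<lambda>n. \<sigma> n t) \<longlonglongrightarrow> h t"
    and bound: "\<And>n. n \<ge> j \<Longrightarrow> L2_norm T (\<sigma> n) \<le> C"
  shows "h \<in> L2 T" and "L2_norm T h \<le> C"
proof -
  have "0 \<le> C" using bound[of j] L2_norm_nonneg[of T "\<sigma> j"] by simp
  have m: "(\<lambda>t. (norm (h t))\<^sup>2) \<in> borel_measurable (lebesgue_on {0..T})"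
    using measurable_norm_strongly[OF h] by measurable
  have m\<sigma>: "(\<lambda>t. (norm (\<sigma> n t))\<^sup>2) \<in> borel_measurable (lebesgue_on {0..T})" for n
    using measurable_norm_strongly[OF L2_measurable[OF \<sigma>]] by measurable
  have le: "(\<integral>\<^sup>+t. ennreal ((norm (h t))\<^sup>2) \<partial>lebesgue_on {0..T}) \<le> ennreal (C\<^sup>2)"
  proof -
    have "(\<integral>\<^sup>+t. ennreal ((norm (h t))\<^sup>2) \<partial>lebesgue_on {0..T})
        = (\<integral>\<^sup>+t. liminf (\<lambda>n. ennreal ((norm (\<sigma> n t))\<^sup>2)) \<partial>lebesgue_on {0..T})"
    proof (rule nn_integral_cong_AE)
      show "AE t in lebesgue_on {0..T}.
          ennreal ((norm (h t))\<^sup>2) = liminf (\<lambda>n. ennreal ((norm (\<sigma> n t))\<^sup>2))"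
        using lim
      proof eventually_elim
        case (elim t)
        have "(\<lambda>n. ennreal ((norm (\<sigma> n t))\<^sup>2)) \<longlonglongrightarrow> ennreal ((norm (h t))\<^sup>2)"
          by (intro tendsto_ennrealI tendsto_power tendsto_norm elim)
        then show ?case using lim_imp_Liminf[OF sequentially_bot] by metis
      qed
    qed
    also have "\<dots> \<le> liminf (\<lambda>n. \<integral>\<^sup>+t. ennreal ((norm (\<sigma> n t))\<^sup>2) \<partial>lebesgue_on {0..T})"
      by (intro nn_integral_liminf measurable_compose[OF m\<sigma> measurable_ennreal])
    also have "\<dots> \<le> ennreal (C\<^sup>2)"
    proof (rule Liminf_le)
      have "(\<integral>\<^sup>+t. ennreal ((norm (\<sigma> n t))\<^sup>2) \<partial>lebesgue_on {0..T}) \<le> ennreal (C\<^sup>2)" if "n \<ge> j" for n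
      proof -
        have "(\<integral>\<^sup>+t. ennreal ((norm (\<sigma> n t))\<^sup>2) \<partial>lebesgue_on {0..T}) = ennreal ((L2_norm T (\<sigma> n))\<^sup>2)"
          unfolding L2_norm_power2 using L2_square_integrable[OF \<sigma>]
          by (intro nn_integral_eq_integral) auto
        also have "\<dots> \<le> ennreal (C\<^sup>2)"
          using bound[OF that] by (intro ennreal_leI power_mono) (auto simp: L2_norm_nonneg)
        finally show ?thesis .
      qed
      then show "\<forall>\<^sub>F n in sequentially. (\<integral>\<^sup>+t. ennreal ((norm (\<sigma> n t))\<^sup>2) \<partial>lebesgue_on {0..T}) \<le> ennreal (C\<^sup>2)"
        by (auto simp: eventually_sequentially)
    qed simp
    finally show ?thesis .
  qed
  then have "(\<integral>\<^sup>+t. ennreal (norm ((norm (h t))\<^sup>2)) \<partial>lebesgue_on {0..T}) < \<infinity>"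
    by (auto simp: ennreal_less_top intro: le_less_trans)
  then have int: "integrable (lebesgue_on {0..T}) (\<lambda>t. (norm (h t))\<^sup>2)"
    using m by (simp add: integrable_iff_bounded)
  then show "h \<in> L2 T" using h by (simp add: L2_def)
  have "ennreal ((L2_norm T h)\<^sup>2) \<le> ennreal (C\<^sup>2)"
    unfolding L2_norm_power2 using nn_integral_eq_integral[OF int] le by simp
  then have "(L2_norm T h)\<^sup>2 \<le> C\<^sup>2" by simp
  then show "L2_norm T h \<le> C" using \<open>0 \<le> C\<close> by (rule power2_le_imp_le)
qed

lemma L2_simple:
  assumes s: "simple_function (lebesgue_on {0..T}) s"
  shows "s \<in> L2 T"
proof (cases "T \<ge> 0")
  case True
  have fin: "finite (s ` {0..T})" using simple_functionD(1)[OF s] by simp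
  have "norm (s t) \<le> Max (norm ` s ` {0..T})" if "t \<in> {0..T}" for t
    using fin that by (intro Max_ge) auto
  then show ?thesis by (rule L2_bounded[OF strongly_measurable_simple[OF s]])
next
  case False
  then show ?thesis by (intro L2_bounded[OF strongly_measurable_simple[OF s], of 0]) auto
qed

text \<open>
  The approximating simple functions are cut off where they exceed twice the limit, so that
  dominated convergence applies.
\<close>

lemma L2_simple_approximation:
  assumes f: "f \<in> L2 T" and "e > 0"
  obtains s where "simple_function (lebesgue_on {0..T}) s" and "L2_norm T (\<lambda>t. f t - s t) < e"
proof -
  let ?M = "lebesgue_on {0..T}"
  obtain s f' where s: "\<And>n::nat. simple_function ?M (s n)"
    and lim: "\<And>t. t \<in> space ?M \<Longrightarrow> (\<lambda>n. s n t) \<longlonglongrightarrow> f' t" and ae: "AE t in ?M. f' t = f t"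
    by (rule strongly_measurable_everywhere[OF L2_measurable[OF f]]) (rule that)
  have f': "strongly_measurable ?M f'"
    unfolding strongly_measurable_def using s lim by (intro exI[of _ s]) (auto intro: AE_I2)
  have f'2: "f' \<in> L2 T" by (rule L2_AE(1)[OF f' f ae])
  have m: "(\<lambda>t. norm (f' t)) \<in> borel_measurable ?M" by (rule measurable_norm_strongly[OF f'])
  define r where "r n t = (if norm (s n t) \<le> 2 * norm (f' t) then s n t else 0)" for n t
  have r: "simple_function ?M (r n)" for n
  proof -
    have "(\<lambda>t. norm (s n t)) \<in> borel_measurable ?M"
      by (intro borel_measurable_simple_function simple_function_compose1[OF s])
    with m have "{t \<in> space ?M. norm (s n t) \<le> 2 * norm (f' t)} \<in> sets ?M" by measurable
    then show ?thesis unfolding r_def by (intro simple_function_If s) auto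
  qed
  have r_lim: "(\<lambda>n. r n t) \<longlonglongrightarrow> f' t" if t: "t \<in> space ?M" for t
  proof (cases "f' t = 0")
    case True
    then have "r n t = 0" for n by (simp add: r_def)
    then show ?thesis using True by simp
  next
    case False
    have "(\<lambda>n. norm (s n t)) \<longlonglongrightarrow> norm (f' t)" by (intro tendsto_norm lim t)
    then have "\<forall>\<^sub>F n in sequentially. norm (s n t) < 2 * norm (f' t)"
      using False by (intro order_tendstoD(2)) auto
    then have "\<forall>\<^sub>F n in sequentially. s n t = r n t" by eventually_elim (simp add: r_def)
    then show ?thesis using lim[OF t] by (rule Lim_transform_eventually[rotated])
  qed
  have diff: "strongly_measurable ?M (\<lambda>t. f' t - r n t)" for n
    using L2_measurable[OF L2_diff[OF f'2 L2_simple[OF r]]] .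
  have "(\<lambda>n. \<integral>t. (norm (f' t - r n t))\<^sup>2 \<partial>?M) \<longlonglongrightarrow> (\<integral>t. 0 \<partial>?M)"
  proof (rule integral_dominated_convergence)
    show "integrable ?M (\<lambda>t. 9 * (norm (f' t))\<^sup>2)" using L2_square_integrable[OF f'2] by simp
    show "(\<lambda>t. (norm (f' t - r n t))\<^sup>2) \<in> borel_measurable ?M" for n
      using measurable_norm_strongly[OF diff] by measurable
    have "(\<lambda>n. (norm (f' t - r n t))\<^sup>2) \<longlonglongrightarrow> 0" if "t \<in> space ?M" for t
    proof -
      have "(\<lambda>n. (norm (f' t - r n t))\<^sup>2) \<longlonglongrightarrow> (norm (f' t - f' t))\<^sup>2"
        by (intro tendsto_intros r_lim that)
      then show ?thesis by simp
    qed
    then show "AE t in ?M. (\<lambda>n. (norm (f' t - r n t))\<^sup>2) \<longlonglongrightarrow> 0" by (rule AE_I2)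
    have "(norm (f' t - r n t))\<^sup>2 \<le> 9 * (norm (f' t))\<^sup>2" for n t
    proof -
      have "norm (r n t) \<le> 2 * norm (f' t)" by (simp add: r_def)
      then have "norm (f' t - r n t) \<le> 3 * norm (f' t)"
        using norm_triangle_ineq4[of "f' t" "r n t"] by simp
      then have "(norm (f' t - r n t))\<^sup>2 \<le> (3 * norm (f' t))\<^sup>2" by (intro power_mono) auto
      then show ?thesis by (simp add: power_mult_distrib)
    qed
    then show "AE t in ?M. norm ((norm (f' t - r n t))\<^sup>2) \<le> 9 * (norm (f' t))\<^sup>2" for n by simp
  qed simp
  then have "(\<lambda>n. L2_norm T (\<lambda>t. f' t - r n t)) \<longlonglongrightarrow> sqrt 0"
    unfolding L2_norm_def by (intro tendsto_real_sqrt) simp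
  then have "\<forall>\<^sub>F n in sequentially. L2_norm T (\<lambda>t. f' t - r n t) < e"
    using \<open>e > 0\<close> by (intro order_tendstoD(2)) auto
  then obtain n where n: "L2_norm T (\<lambda>t. f' t - r n t) < e"
    by (meson eventually_happens' sequentially_bot)
  have "L2_norm T (\<lambda>t. f t - r n t) = L2_norm T (\<lambda>t. f' t - r n t)"
  proof (rule L2_AE(2))
    show "strongly_measurable ?M (\<lambda>t. f t - r n t)"
      using L2_measurable[OF L2_diff[OF f L2_simple[OF r]]] .
    show "(\<lambda>t. f' t - r n t) \<in> L2 T" by (rule L2_diff[OF f'2 L2_simple[OF r]])
    show "AE t in ?M. f t - r n t = f' t - r n t" using ae by eventually_elim simp
  qed
  then show thesis using that[OF r, of n] n by simp
qed

text \<open>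
  The Riesz--Fischer theorem. Replacing the members of the sequence by nearby simple functions
  first makes strong measurability of the limit immediate.
\<close>

lemma L2_complete:
  fixes a :: "nat \<Rightarrow> real \<Rightarrow> 'x::{real_inner, banach}"
  assumes "T \<ge> 0" and a: "\<And>n. a n \<in> L2 T"
    and cau: "\<And>e. e > 0 \<Longrightarrow> \<exists>N. \<forall>m\<ge>N. \<forall>n\<ge>N. L2_norm T (\<lambda>t. a m t - a n t) < e"
  obtains h where "h \<in> L2 T" and "(\<lambda>n. L2_norm T (\<lambda>t. a n t - h t)) \<longlonglongrightarrow> 0"
proof -
  let ?M = "lebesgue_on {0..T}"
  have "\<exists>s. simple_function ?M s \<and> L2_norm T (\<lambda>t. a n t - s t) < (1/2)^n" for n
    by (rule L2_simple_approximation[OF a, of "(1/2)^n" n]) auto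
  then obtain s where s: "\<And>n. simple_function ?M (s n)"
    and as: "\<And>n. L2_norm T (\<lambda>t. a n t - s n t) < (1/2)^n" by metis
  have "\<exists>N. \<forall>m\<ge>N. \<forall>n\<ge>N. L2_norm T (\<lambda>t. a m t - a n t) < (1/2)^k" for k :: nat
    by (rule cau) simp
  then obtain N :: "nat \<Rightarrow> nat"
    where N: "\<And>k m n. m \<ge> N k \<Longrightarrow> n \<ge> N k \<Longrightarrow> L2_norm T (\<lambda>t. a m t - a n t) < (1/2)^k"
    by metis
  \<comment> \<open>the sum makes \<open>p k\<close> at least \<open>N i\<close> for all \<open>i \<le> k\<close>, whether or not \<open>N\<close> is monotone\<close>
  define p where "p k = k + (\<Sum>i\<le>k. N i)" for k
  have p: "p k \<ge> N i" if "i \<le> k" for i k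
    using member_le_sum[of i "{..k}" N] that by (simp add: p_def)
  have pk: "p k \<ge> k" for k by (simp add: p_def)
  define \<sigma> where "\<sigma> k = s (p k)" for k
  have \<sigma>: "\<sigma> k \<in> L2 T" for k unfolding \<sigma>_def by (rule L2_simple[OF s])
  have a\<sigma>: "L2_norm T (\<lambda>t. a m t - \<sigma> k t) \<le> 2 * (1/2)^j" if "m \<ge> N j" "j \<le> k" for m j k
  proof -
    have "L2_norm T (\<lambda>t. a m t - \<sigma> k t)
        \<le> L2_norm T (\<lambda>t. a m t - a (p k) t) + L2_norm T (\<lambda>t. a (p k) t - \<sigma> k t)"
      by (rule L2_norm_triangle_diff[OF a a \<sigma>])
    also have "\<dots> \<le> (1/2)^j + (1/2)^p k"
      using N[OF that(1) p[OF that(2)]] as[of "p k"] unfolding \<sigma>_def by linarith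
    also have "(1/2)^p k \<le> (1/2::real)^j"
      using pk[of k] that(2) by (intro power_decreasing) auto
    finally show ?thesis by simp
  qed
  have step: "L2_norm T (\<lambda>t. \<sigma> (Suc k) t - \<sigma> k t) \<le> 4 * (1/2)^k" for k
  proof -
    have "L2_norm T (\<lambda>t. \<sigma> (Suc k) t - \<sigma> k t)
        \<le> L2_norm T (\<lambda>t. \<sigma> (Suc k) t - a (p k) t) + L2_norm T (\<lambda>t. a (p k) t - \<sigma> k t)"
      by (rule L2_norm_triangle_diff[OF \<sigma> a \<sigma>])
    also have "\<dots> \<le> 2 * (1/2)^k + 2 * (1/2)^k"
      using a\<sigma>[of k "p k" "Suc k"] a\<sigma>[of k "p k" k] p[of k k]
      by (simp add: L2_norm_minus_commute[of T "\<sigma> (Suc k)"])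
    finally show ?thesis by simp
  qed
  have "AE t in ?M. (\<Sum>k. ennreal (norm (\<sigma> (Suc k) t - \<sigma> k t))) \<noteq> \<infinity>"
  proof (rule nn_integral_PInf_AE)
    have d: "(\<lambda>t. \<sigma> (Suc k) t - \<sigma> k t) \<in> L2 T" for k by (rule L2_diff[OF \<sigma> \<sigma>])
    have m: "(\<lambda>t. ennreal (norm (\<sigma> (Suc k) t - \<sigma> k t))) \<in> borel_measurable ?M" for k
      by (rule measurable_compose[OF measurable_norm_strongly[OF L2_measurable[OF d]] measurable_ennreal])
    then show "(\<lambda>t. \<Sum>k. ennreal (norm (\<sigma> (Suc k) t - \<sigma> k t))) \<in> borel_measurable ?M"
      by (rule borel_measurable_suminf_order)
    have "(\<integral>\<^sup>+t. (\<Sum>k. ennreal (norm (\<sigma> (Suc k) t - \<sigma> k t))) \<partial>?M)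
        = (\<Sum>k. \<integral>\<^sup>+t. ennreal (norm (\<sigma> (Suc k) t - \<sigma> k t)) \<partial>?M)"
      using m by (intro nn_integral_suminf)
    also have "\<dots> \<le> (\<Sum>k. ennreal (sqrt T * (4 * (1/2)^k)))"
    proof (rule suminf_le)
      fix k
      have "(\<integral>\<^sup>+t. ennreal (norm (\<sigma> (Suc k) t - \<sigma> k t)) \<partial>?M)
          = ennreal (\<integral>t. norm (\<sigma> (Suc k) t - \<sigma> k t) \<partial>?M)"
        by (intro nn_integral_eq_integral integrable_L2_norm[OF d]) simp
      also have "\<dots> \<le> ennreal (sqrt T * (4 * (1/2)^k))"
        using L1_le_L2[OF \<open>T \<ge> 0\<close> d, of k] mult_left_mono[OF step, of "sqrt T" k] \<open>T \<ge> 0\<close>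
        by (intro ennreal_leI) simp
      finally show "(\<integral>\<^sup>+t. ennreal (norm (\<sigma> (Suc k) t - \<sigma> k t)) \<partial>?M) \<le> ennreal (sqrt T * (4 * (1/2)^k))" .
    qed auto
    also have "\<dots> < \<infinity>"
    proof -
      have "summable (\<lambda>k. sqrt T * (4 * (1/2)^k))"
        by (intro summable_mult summable_geometric) simp
      then show ?thesis
        using \<open>T \<ge> 0\<close> by (subst suminf_ennreal2) (auto simp: ennreal_less_top)
    qed
    finally show "(\<integral>\<^sup>+t. (\<Sum>k. ennreal (norm (\<sigma> (Suc k) t - \<sigma> k t))) \<partial>?M) \<noteq> \<infinity>" by simp
  qed
  then have conv: "AE t in ?M. (\<lambda>k. \<sigma> k t) \<longlonglongrightarrow> lim (\<lambda>k. \<sigma> k t)"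
  proof eventually_elim
    case (elim t)
    then have "summable (\<lambda>k. norm (\<sigma> (Suc k) t - \<sigma> k t))"
      by (intro summable_suminf_not_top) auto
    then have "summable (\<lambda>k. \<sigma> (Suc k) t - \<sigma> k t)" by (rule summable_norm_cancel)
    then have "(\<lambda>n. \<Sum>k<n. \<sigma> (Suc k) t - \<sigma> k t) \<longlonglongrightarrow> (\<Sum>k. \<sigma> (Suc k) t - \<sigma> k t)"
      by (rule summable_LIMSEQ)
    then have "(\<lambda>n. (\<sigma> n t - \<sigma> 0 t) + \<sigma> 0 t) \<longlonglongrightarrow> (\<Sum>k. \<sigma> (Suc k) t - \<sigma> k t) + \<sigma> 0 t"
      unfolding sum_lessThan_telescope[of "\<lambda>k. \<sigma> k t"] by (intro tendsto_add tendsto_const)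
    then show ?case by (simp add: convergent_LIMSEQ_iff[symmetric] convergent_def) blast
  qed
  define h where "h t = lim (\<lambda>k. \<sigma> k t)" for t
  have h: "strongly_measurable ?M h"
    unfolding strongly_measurable_def h_def using conv s by (intro exI[of _ \<sigma>]) (simp add: \<sigma>_def)
  have close: "(\<lambda>t. a m t - h t) \<in> L2 T" "L2_norm T (\<lambda>t. a m t - h t) \<le> 2 * (1/2)^j"
    if "m \<ge> N j" for m j
  proof -
    have sm: "strongly_measurable ?M (\<lambda>t. a m t - h t)"
      by (rule strongly_measurable_compose2[OF L2_measurable[OF a] h, where h = "(-)"]) (rule tendsto_diff)
    have "AE t in ?M. (\<lambda>k. a m t - \<sigma> k t) \<longlonglongrightarrow> a m t - h t"
      using conv by eventually_elim (auto simp: h_def intro: tendsto_diff)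
    from L2_fatou[OF L2_diff[OF a \<sigma>] sm this a\<sigma>[OF that]]
    show "(\<lambda>t. a m t - h t) \<in> L2 T" "L2_norm T (\<lambda>t. a m t - h t) \<le> 2 * (1/2)^j" by auto
  qed
  show thesis
  proof
    show "h \<in> L2 T" using L2_diff[OF a close(1)[of 0 "N 0"], of "N 0"] by simp
    show "(\<lambda>n. L2_norm T (\<lambda>t. a n t - h t)) \<longlonglongrightarrow> 0"
    proof (rule LIMSEQ_I)
      fix e :: real assume "e > 0"
      then obtain j where j: "(1/2)^j < e / 2" using real_arch_pow_inv[of "e/2" "1/2"] by auto
      have "norm (L2_norm T (\<lambda>t. a n t - h t) - 0) < e" if "n \<ge> N j" for n
        using close(2)[OF that] j by (simp add: L2_norm_nonneg)
      then show "\<exists>no. \<forall>n\<ge>no. norm (L2_norm T (\<lambda>t. a n t - h t) - 0) < e" by blast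
    qed
  qed
qed

text \<open>
  Riemann sums of a function that is small in \<open>L\<^sup>1\<close> are small along fine divisions. Hence the gauge
  integrable functions are closed under approximation in \<open>L\<^sup>1\<close>, in any Banach space.
\<close>

lemma integrable_on_L1_approximation:
  fixes f :: "real \<Rightarrow> 'b::banach"
  assumes "\<And>e. e > 0 \<Longrightarrow> \<exists>s g I. s integrable_on {a..b} \<and> (g has_integral I) {a..b} \<and> I < e \<and>
      (\<forall>t\<in>{a..b}. norm (f t - s t) \<le> g t)"
  shows "f integrable_on {a..b}"
proof -
  have "f integrable_on cbox a b"
    unfolding integrable_Cauchy
  proof (intro allI impI)
    fix e :: real assume "e > 0"
    obtain s g I where s: "s integrable_on cbox a b" and g: "(g has_integral I) (cbox a b)"
      and "I < e / 8" and le: "\<And>t. t \<in> cbox a b \<Longrightarrow> norm (f t - s t) \<le> g t"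
      using assms[of "e / 8"] \<open>e > 0\<close> by auto
    obtain \<gamma>1 where "gauge \<gamma>1" and \<gamma>1: "\<And>\<D>1 \<D>2. \<D>1 tagged_division_of cbox a b \<Longrightarrow> \<gamma>1 fine \<D>1 \<Longrightarrow>
        \<D>2 tagged_division_of cbox a b \<Longrightarrow> \<gamma>1 fine \<D>2 \<Longrightarrow>
        norm ((\<Sum>(x,K)\<in>\<D>1. measure lborel K *\<^sub>R s x) - (\<Sum>(x,K)\<in>\<D>2. measure lborel K *\<^sub>R s x)) < e / 4"
      using s[unfolded integrable_Cauchy, THEN spec[of _ "e / 4"]] \<open>e > 0\<close> by auto
    obtain \<gamma>2 where "gauge \<gamma>2" and \<gamma>2: "\<And>\<D>. \<D> tagged_division_of cbox a b \<Longrightarrow> \<gamma>2 fine \<D> \<Longrightarrow>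
        norm ((\<Sum>(x,K)\<in>\<D>. measure lborel K *\<^sub>R g x) - I) < e / 8"
      using g[unfolded has_integral, THEN spec[of _ "e / 8"]] \<open>e > 0\<close> by auto
    have near: "norm ((\<Sum>(x,K)\<in>\<D>. measure lborel K *\<^sub>R f x) - (\<Sum>(x,K)\<in>\<D>. measure lborel K *\<^sub>R s x)) < e / 4"
      if \<D>: "\<D> tagged_division_of cbox a b" "\<gamma>2 fine \<D>" for \<D>
    proof -
      have "norm ((\<Sum>(x,K)\<in>\<D>. measure lborel K *\<^sub>R f x) - (\<Sum>(x,K)\<in>\<D>. measure lborel K *\<^sub>R s x))
          = norm (\<Sum>(x,K)\<in>\<D>. measure lborel K *\<^sub>R (f x - s x))"
        by (simp add: sum_subtractf[symmetric] case_prod_unfold scaleR_diff_right)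
      also have "\<dots> \<le> (\<Sum>(x,K)\<in>\<D>. measure lborel K *\<^sub>R g x)"
      proof (rule sum_norm_le)
        fix z assume "z \<in> \<D>"
        then obtain x K where z: "z = (x, K)" "(x, K) \<in> \<D>" by (cases z) auto
        then have "x \<in> cbox a b" using tag_in_interval[OF \<D>(1)] by blast
        then show "norm (case z of (x, K) \<Rightarrow> measure lborel K *\<^sub>R (f x - s x)) \<le> (case z of (x, K) \<Rightarrow> measure lborel K *\<^sub>R g x)"
          using le by (simp add: z(1) mult_left_mono)
      qed
      also have "\<dots> < I + e / 8" using \<gamma>2[OF \<D>] unfolding real_norm_def by linarith
      finally show ?thesis using \<open>I < e / 8\<close> by simp
    qed
    show "\<exists>\<gamma>. gauge \<gamma> \<and> (\<forall>\<D>1 \<D>2. \<D>1 tagged_division_of cbox a b \<and> \<gamma> fine \<D>1 \<and>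
        \<D>2 tagged_division_of cbox a b \<and> \<gamma> fine \<D>2 \<longrightarrow>
        norm ((\<Sum>(x,K)\<in>\<D>1. measure lborel K *\<^sub>R f x) - (\<Sum>(x,K)\<in>\<D>2. measure lborel K *\<^sub>R f x)) < e)"
    proof (intro exI[of _ "\<lambda>x. \<gamma>1 x \<inter> \<gamma>2 x"] conjI allI impI)
      show "gauge (\<lambda>x. \<gamma>1 x \<inter> \<gamma>2 x)" using \<open>gauge \<gamma>1\<close> \<open>gauge \<gamma>2\<close> by (rule gauge_Int)
      fix \<D>1 \<D>2
      assume *: "\<D>1 tagged_division_of cbox a b \<and> (\<lambda>x. \<gamma>1 x \<inter> \<gamma>2 x) fine \<D>1 \<and>
        \<D>2 tagged_division_of cbox a b \<and> (\<lambda>x. \<gamma>1 x \<inter> \<gamma>2 x) fine \<D>2"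
      let ?R = "\<lambda>h \<D>. \<Sum>(x,K)\<in>\<D>. measure lborel K *\<^sub>R h x"
      have "norm (?R s \<D>1 - ?R s \<D>2) < e / 4" "norm (?R f \<D>1 - ?R s \<D>1) < e / 4"
          "norm (?R s \<D>2 - ?R f \<D>2) < e / 4"
        using * near[of \<D>1] near[of \<D>2] \<gamma>1[of \<D>1 \<D>2] by (auto simp: fine_Int norm_minus_commute)
      moreover have "norm (a - d) < e"
        if "norm (b - c) < e / 4" "norm (a - b) < e / 4" "norm (c - d) < e / 4" for a b c d :: 'b
        using norm_triangle_ineq[of "a - b" "b - d"] norm_triangle_ineq[of "b - c" "c - d"] that
          \<open>e > 0\<close> by simp
      ultimately show "norm (?R f \<D>1 - ?R f \<D>2) < e" by blast
    qed
  qed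
  then show ?thesis by simp
qed

lemma integrable_on_simple:
  fixes s :: "real \<Rightarrow> 'b::banach"
  assumes s: "simple_function (lebesgue_on {0..T}) s"
  shows "s integrable_on {0..T}"
proof -
  let ?E = "\<lambda>x. s -` {x} \<inter> {0..T}"
  have fin: "finite (s ` {0..T})" using simple_functionD(1)[OF s] by simp
  have "(\<lambda>t. indicat_real (?E x) t *\<^sub>R x) integrable_on {0..T}" for x
  proof (rule integrable_on_scaleR_left)
    have E: "?E x \<in> sets (lebesgue_on {0..T})" using simple_functionD(2)[OF s] by simp
    interpret finite_measure "lebesgue_on {0..T}" by (rule finite_measure_interval)
    have "integrable (lebesgue_on {0..T}) (indicat_real (?E x))"
      using E by (simp add: emeasure_eq_measure)
    then show "indicat_real (?E x) integrable_on {0..T}" by (intro integrable_on_lebesgue_on) auto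
  qed
  then have "(\<lambda>t. \<Sum>x\<in>s ` {0..T}. indicat_real (?E x) t *\<^sub>R x) integrable_on {0..T}"
    using fin by (intro integrable_sum) auto
  moreover have "(\<Sum>x\<in>s ` {0..T}. indicat_real (?E x) t *\<^sub>R x) = s t" if "t \<in> {0..T}" for t
  proof -
    have "(\<Sum>x\<in>s ` {0..T}. indicat_real (?E x) t *\<^sub>R x) = (\<Sum>x\<in>s ` {0..T}. if x = s t then x else 0)"
      using that by (intro sum.cong) (auto simp: indicator_def)
    then show ?thesis using fin that by simp
  qed
  ultimately show ?thesis by (rule integrable_eq)
qed

text \<open>
  This makes sense of the variation of constants formula, whose integral is a gauge integral.
\<close>

lemma L2_integrable_on:
  fixes f :: "real \<Rightarrow> 'x::{real_inner, banach}"
  assumes "T \<ge> 0" and f: "f \<in> L2 T"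
  shows "f integrable_on {0..T}"
proof (rule integrable_on_L1_approximation)
  fix e :: real assume "e > 0"
  have pos: "sqrt T + 1 > 0" using \<open>T \<ge> 0\<close> by (simp add: add_nonneg_pos)
  obtain s where s: "simple_function (lebesgue_on {0..T}) s"
    and fs: "L2_norm T (\<lambda>t. f t - s t) < e / (sqrt T + 1)"
    using L2_simple_approximation[OF f, of "e / (sqrt T + 1)"] \<open>e > 0\<close> pos by auto
  have d: "(\<lambda>t. f t - s t) \<in> L2 T" by (rule L2_diff[OF f L2_simple[OF s]])
  let ?I = "\<integral>t. norm (f t - s t) \<partial>lebesgue_on {0..T}"
  have "?I \<le> sqrt T * L2_norm T (\<lambda>t. f t - s t)" by (rule L1_le_L2[OF \<open>T \<ge> 0\<close> d])
  also have "\<dots> \<le> (sqrt T + 1) * L2_norm T (\<lambda>t. f t - s t)"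
    by (intro mult_right_mono) (auto simp: L2_norm_nonneg)
  also have "\<dots> < e" using fs pos by (simp add: pos_less_divide_eq mult.commute)
  finally have "?I < e" .
  moreover have "((\<lambda>t. norm (f t - s t)) has_integral ?I) {0..T}"
    by (intro has_integral_integral_lebesgue_on integrable_L2_norm[OF d]) simp
  ultimately show "\<exists>s g I. s integrable_on {0..T} \<and> (g has_integral I) {0..T} \<and> I < e \<and>
      (\<forall>t\<in>{0..T}. norm (f t - s t) \<le> g t)"
    using integrable_on_simple[OF s] by blast
qed

text \<open>
  Backward solutions are forward solutions run in reversed time, so the reflection of the time
  interval must preserve \<open>L\<^sup>2\<close>.
\<close>

lemma reflection_measurable: "(\<lambda>t. T - t) \<in> lebesgue_on {0..T} \<rightarrow>\<^sub>M lebesgue_on {0..T::real}"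
  and distr_reflection: "distr (lebesgue_on {0..T}) (lebesgue_on {0..T}) (\<lambda>t. T - t) = lebesgue_on {0..T}"
proof -
  have "(\<lambda>t. T + (-1) * t) \<in> lebesgue \<rightarrow>\<^sub>M lebesgue"
    using lebesgue_affine_measurable[of "\<lambda>_. -1::real" T] by simp
  then have leb: "(\<lambda>t. T - t) \<in> lebesgue \<rightarrow>\<^sub>M lebesgue" by simp
  then show meas: "(\<lambda>t. T - t) \<in> lebesgue_on {0..T} \<rightarrow>\<^sub>M lebesgue_on {0..T}"
    by (intro measurable_restrict_space3) auto
  show "distr (lebesgue_on {0..T}) (lebesgue_on {0..T}) (\<lambda>t. T - t) = lebesgue_on {0..T}"
  proof (rule measure_eqI)
    fix A assume "A \<in> sets (distr (lebesgue_on {0..T}) (lebesgue_on {0..T}) (\<lambda>t. T - t))"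
    then have A: "A \<in> sets (lebesgue_on {0..T})" by simp
    then have A': "A \<in> sets lebesgue" "A \<subseteq> {0..T}" by (auto simp: sets_restrict_space_iff)
    have pre: "(\<lambda>t. T - t) -` A \<inter> {0..T} = (\<lambda>t. (-1) *\<^sub>R t + T) ` A"
      using A'(2) by (auto simp: image_iff intro!: bexI[of _ "T - _"])
    have "emeasure (distr (lebesgue_on {0..T}) (lebesgue_on {0..T}) (\<lambda>t. T - t)) A
        = emeasure (lebesgue_on {0..T}) ((\<lambda>t. T - t) -` A \<inter> {0..T})"
      using emeasure_distr[OF meas A] by simp
    also have "\<dots> = emeasure lebesgue ((\<lambda>t. T - t) -` A \<inter> {0..T})"
      by (intro emeasure_restrict_space) auto
    also have "\<dots> = emeasure lebesgue A"
      unfolding pre by (subst emeasure_lebesgue_affine) simp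
    also have "\<dots> = emeasure (lebesgue_on {0..T}) A"
      using A' by (subst emeasure_restrict_space) auto
    finally show "emeasure (distr (lebesgue_on {0..T}) (lebesgue_on {0..T}) (\<lambda>t. T - t)) A
        = emeasure (lebesgue_on {0..T}) A" .
  qed simp
qed

lemma L2_reflection:
  assumes f: "f \<in> L2 T"
  shows "(\<lambda>t. f (T - t)) \<in> L2 T"
proof -
  let ?M = "lebesgue_on {0..T}"
  obtain s where s: "\<And>n::nat. simple_function ?M (s n)" "AE t in ?M. (\<lambda>n. s n t) \<longlonglongrightarrow> f t"
    using L2_measurable[OF f] unfolding strongly_measurable_def by blast
  have "simple_function ?M (\<lambda>t. s n (T - t))" for n
    by (rule simple_function_comp[OF reflection_measurable s(1)])
  moreover have "AE t in ?M. (\<lambda>n. s n (T - t)) \<longlonglongrightarrow> f (T - t)"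
    by (rule AE_distrD[OF reflection_measurable]) (unfold distr_reflection, rule s(2))
  ultimately have "strongly_measurable ?M (\<lambda>t. f (T - t))"
    unfolding strongly_measurable_def by (intro exI[of _ "\<lambda>n t. s n (T - t)"]) auto
  moreover have "integrable ?M (\<lambda>t. (norm (f (T - t)))\<^sup>2)"
    by (rule integrable_distr[OF reflection_measurable])
      (unfold distr_reflection, rule L2_square_integrable[OF f])
  ultimately show ?thesis by (simp add: L2_def)
qed

lemma integral_reflection:
  fixes f :: "real \<Rightarrow> real"
  assumes "f \<in> borel_measurable (lebesgue_on {0..T})"
  shows "(\<integral>t. f (T - t) \<partial>lebesgue_on {0..T}) = (\<integral>t. f t \<partial>lebesgue_on {0..T})"
  using integral_distr[OF reflection_measurable assms] unfolding distr_reflection by simp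

section \<open>Strongly continuous semigroups and their adjoints\<close>

locale c0_semigroup =
  fixes S :: "real \<Rightarrow> 'x \<Rightarrow> 'x::banach"
  assumes C0: "C0_semigroup S"
begin

lemma bounded_linear: "0 \<le> t \<Longrightarrow> bounded_linear (S t)"
  and zero_time: "S 0 x = x"
  and add_time: "0 \<le> s \<Longrightarrow> 0 \<le> t \<Longrightarrow> S (s + t) x = S s (S t x)"
  and tendsto_at_0: "((\<lambda>t. S t x) \<longlongrightarrow> x) (at_right 0)"
  using C0 by (auto simp: C0_semigroup_def)

lemma linear_time:
  assumes "0 \<le> t"
  shows "S t (x + y) = S t x + S t y" "S t (x - y) = S t x - S t y"
    "S t (r *\<^sub>R x) = r *\<^sub>R S t x" "S t 0 = 0" "S t (- x) = - S t x"
  using bounded_linear[OF assms]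
  by (simp_all add: linear_simps bounded_linear.linear linear_add linear_diff linear_scale linear_0 linear_neg)

text \<open>
  By the Baire category theorem, one of the closed sets of vectors whose orbit stays bounded by \<open>n\<close>
  on \<open>[0, 1/(n+1)]\<close> has interior.
\<close>

lemma bounded_near_0:
  obtains K \<delta> where "K \<ge> 1" and "\<delta> > 0" and "\<And>t x. t \<in> {0..\<delta>} \<Longrightarrow> norm (S t x) \<le> K * norm x"
proof -
  define E where "E n = (\<Inter>t\<in>{0..1 / (real n + 1)}. {x. norm (S t x) \<le> real n})" for n
  have closed: "closed (E n)" for n
    unfolding E_def
    by (intro closed_INT ballI closed_Collect_le continuous_intros bounded_linear.continuous_on[OF bounded_linear]) auto
  have "\<exists>n. x \<in> E n" for x
  proof -
    have "\<forall>\<^sub>F t in at_right 0. norm (S t x) < norm x + 1"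
      using tendsto_norm[OF tendsto_at_0[of x]] by (rule order_tendstoD) simp
    then obtain b where "b > 0" and b: "\<And>t. 0 < t \<Longrightarrow> t < b \<Longrightarrow> norm (S t x) < norm x + 1"
      by (auto simp: eventually_at_right_field)
    obtain n :: nat where n: "real n > max (norm x + 1) (1 / b)" using reals_Archimedean2 by blast
    have "1 / (real n + 1) < b"
      using n \<open>b > 0\<close> by (simp add: field_simps)
    then have "norm (S t x) \<le> real n" if "t \<in> {0..1 / (real n + 1)}" for t
      using b[of t] that n zero_time[of x] by (cases "t = 0") auto
    then show ?thesis unfolding E_def by blast
  qed
  then have "(\<Union>n. E n) = UNIV" by blast
  have "\<exists>n. interior (E n) \<noteq> {}"
  proof (rule ccontr)
    assume "\<nexists>n. interior (E n) \<noteq> {}"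
    then have "(euclidean :: 'x topology) interior_of \<Union>(range E) = {}"
      using closed completely_metrizable_space_euclidean
      by (intro Baire_category_alt) auto
    then show False using \<open>(\<Union>n. E n) = UNIV\<close> by simp
  qed
  then obtain n x0 where "x0 \<in> interior (E n)" by blast
  then obtain r where "r > 0" and r: "cball x0 r \<subseteq> E n"
    by (meson mem_interior_cball)
  show thesis
  proof (rule that[of "max 1 (2 * real n / r)" "1 / (real n + 1)"])
    fix t x assume t: "t \<in> {0..1 / (real n + 1)}"
    show "norm (S t x) \<le> max 1 (2 * real n / r) * norm x"
    proof (cases "x = 0")
      case False
      define y where "y = (r / norm x) *\<^sub>R x"
      have "norm y = r" using False \<open>r > 0\<close> by (simp add: y_def)
      then have "x0 + y \<in> E n" "x0 \<in> E n" using r \<open>r > 0\<close> by (auto simp: dist_norm)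
      then have "norm (S t (x0 + y)) \<le> real n" "norm (S t x0) \<le> real n" using t by (auto simp: E_def)
      then have "norm (S t y) \<le> 2 * real n"
        using norm_triangle_ineq4[of "S t (x0 + y)" "S t x0"] t by (simp add: linear_time)
      moreover have "norm (S t y) = (r / norm x) * norm (S t x)"
        using t \<open>r > 0\<close> by (simp add: y_def linear_time)
      ultimately have "norm (S t x) \<le> (2 * real n / r) * norm x"
        using False \<open>r > 0\<close> by (simp add: field_simps)
      also have "\<dots> \<le> max 1 (2 * real n / r) * norm x" by (intro mult_right_mono) auto
      finally show ?thesis .
    qed (use t in \<open>simp add: linear_time\<close>)
  qed auto
qed

lemma bounded_on_interval:
  obtains M where "M \<ge> 1" and "\<And>t x. t \<in> {0..T} \<Longrightarrow> norm (S t x) \<le> M * norm x"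
proof -
  obtain K \<delta> where "K \<ge> 1" "\<delta> > 0" and K: "\<And>t x. t \<in> {0..\<delta>} \<Longrightarrow> norm (S t x) \<le> K * norm x"
    by (rule bounded_near_0) (rule that)
  have *: "norm (S t x) \<le> K ^ Suc k * norm x" if "t \<in> {0..(real k + 1) * \<delta>}" for k t x
    using that
  proof (induction k arbitrary: t)
    case 0
    then show ?case using K by simp
  next
    case (Suc k)
    show ?case
    proof (cases "t \<le> \<delta>")
      case True
      then have "norm (S t x) \<le> K * norm x" using Suc.prems by (intro K) auto
      also have "\<dots> \<le> K ^ Suc (Suc k) * norm x"
        using \<open>K \<ge> 1\<close> power_increasing[of 1 "Suc (Suc k)" K] by (intro mult_right_mono) auto
      finally show ?thesis .
    next
      case False
      have "norm (S t x) = norm (S \<delta> (S (t - \<delta>) x))"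
        using add_time[of \<delta> "t - \<delta>" x] \<open>\<delta> > 0\<close> False by simp
      also have "\<dots> \<le> K * norm (S (t - \<delta>) x)" using \<open>\<delta> > 0\<close> by (intro K) auto
      also have "\<dots> \<le> K * (K ^ Suc k * norm x)"
        using Suc.IH[of "t - \<delta>"] Suc.prems False \<open>K \<ge> 1\<close>
        by (intro mult_left_mono) (auto simp: algebra_simps)
      finally show ?thesis by simp
    qed
  qed
  obtain k :: nat where k: "T / \<delta> < real k" using reals_Archimedean2 by blast
  show thesis
  proof (rule that[of "K ^ Suc k"])
    show "1 \<le> K ^ Suc k" using \<open>K \<ge> 1\<close> by (rule one_le_power)
    fix t x assume "t \<in> {0..T}"
    moreover have "T \<le> (real k + 1) * \<delta>" using k \<open>\<delta> > 0\<close> by (simp add: field_simps)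
    ultimately show "norm (S t x) \<le> K ^ Suc k * norm x" by (intro *) auto
  qed
qed

text \<open>
  Joint continuity in time and vector. By the semigroup law, the difference at the times \<open>d n\<close> and
  \<open>t\<close> is the operator at the smaller time applied to a difference at the times \<open>\<bar>d n - t\<bar>\<close> and \<open>0\<close>;
  the operators are uniformly bounded on a bounded time interval.
\<close>

lemma tendsto_strong:
  assumes d: "\<And>n::nat. 0 \<le> d n" "d \<longlonglongrightarrow> t" and X: "X \<longlonglongrightarrow> x"
  shows "(\<lambda>n. S (d n) (X n)) \<longlonglongrightarrow> S t x"
proof -
  have t: "0 \<le> t" using d LIMSEQ_le_const by blast
  obtain T where T: "\<And>n. norm (d n) \<le> T"
    using d(2) convergentI convergent_imp_Bseq by (meson BseqE)
  obtain M where "M \<ge> 1" and M: "\<And>s y. s \<in> {0..max T t} \<Longrightarrow> norm (S s y) \<le> M * norm y"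
    by (rule bounded_on_interval[of "max T t"]) (rule that)
  have small: "(\<lambda>n. S \<bar>d n - t\<bar> x) \<longlonglongrightarrow> x"
  proof -
    have "continuous (at 0 within {0..}) (\<lambda>s. S s x)"
      using tendsto_at_0[of x] zero_time[of x] by (simp add: continuous_within at_within_Ici_at_right)
    moreover have "(\<lambda>n. \<bar>d n - t\<bar>) \<longlonglongrightarrow> 0"
      using d(2) LIM_zero tendsto_rabs_zero by blast
    ultimately show ?thesis
      unfolding continuous_within_sequentially by (auto simp: o_def zero_time)
  qed
  have shift: "norm (S (d n) x - S t x) \<le> M * norm (S \<bar>d n - t\<bar> x - x)" for n
  proof -
    define a where "a = min (d n) t"
    have a: "a \<ge> 0" "a \<in> {0..max T t}" using d(1)[of n] t by (auto simp: a_def)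
    have "norm (S (d n) x - S t x) = norm (S (a + \<bar>d n - t\<bar>) x - S a x)"
      by (cases "d n \<le> t") (auto simp: a_def norm_minus_commute)
    also have "\<dots> = norm (S a (S \<bar>d n - t\<bar> x - x))"
      using a(1) by (simp add: add_time linear_time)
    also have "\<dots> \<le> M * norm (S \<bar>d n - t\<bar> x - x)" by (rule M[OF a(2)])
    finally show ?thesis .
  qed
  have "norm (S (d n) (X n) - S t x) \<le> M * norm (X n - x) + M * norm (S \<bar>d n - t\<bar> x - x)" for n
  proof -
    have "S (d n) (X n) - S t x = S (d n) (X n - x) + (S (d n) x - S t x)"
      using d(1) by (simp add: linear_time)
    then have "norm (S (d n) (X n) - S t x) \<le> norm (S (d n) (X n - x)) + norm (S (d n) x - S t x)"
      using norm_triangle_ineq by metis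
    also have "\<dots> \<le> M * norm (X n - x) + M * norm (S \<bar>d n - t\<bar> x - x)"
      using d(1)[of n] T[of n] by (intro add_mono M shift) auto
    finally show ?thesis .
  qed
  then have bound: "\<forall>\<^sub>F n in sequentially. norm (S (d n) (X n) - S t x)
      \<le> M * norm (X n - x) + M * norm (S \<bar>d n - t\<bar> x - x)" by (rule always_eventually[OF allI])
  have "(\<lambda>n. M * norm (X n - x) + M * norm (S \<bar>d n - t\<bar> x - x)) \<longlonglongrightarrow> M * norm (x - x) + M * norm (x - x)"
    by (intro tendsto_add tendsto_mult tendsto_norm tendsto_diff tendsto_const X small)
  then have "(\<lambda>n. M * norm (X n - x) + M * norm (S \<bar>d n - t\<bar> x - x)) \<longlonglongrightarrow> 0" by simp
  from Lim_null_comparison[OF bound this] show ?thesis by (rule LIM_zero_cancel)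
qed

lemma continuous_on_orbit: "continuous_on {0..} (\<lambda>t. S t x)"
  unfolding continuous_on_sequentially o_def
  by (intro ballI allI impI tendsto_strong[OF _ _ tendsto_const]) auto

lemma integrable_on_orbit: "0 \<le> a \<Longrightarrow> (\<lambda>s. S s x) integrable_on {a..b}"
  by (intro integrable_continuous_real continuous_on_subset[OF continuous_on_orbit]) auto

text \<open>
  Both sides are rearrangements of the integrals over \<open>[h, t + h]\<close> and \<open>[0, t]\<close>. Two intervals of
  length \<open>h\<close> remain, so the right-hand side is of order \<open>h\<close>: this puts the integral into the domain of
  the generator, and it gives the strong continuity of the adjoint semigroup.
\<close>

lemma integral_orbit_shift:
  assumes "0 \<le> t" "0 \<le> h"
  shows "S h (integral {0..t} (\<lambda>s. S s x)) - integral {0..t} (\<lambda>s. S s x)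
    = integral {t..t + h} (\<lambda>s. S s x) - integral {0..h} (\<lambda>s. S s x)"
proof -
  have "S h (integral {0..t} (\<lambda>s. S s x)) = integral {0..t} (S h \<circ> (\<lambda>s. S s x))"
    by (rule integral_linear[symmetric, OF integrable_on_orbit bounded_linear]) (use assms in auto)
  also have "\<dots> = integral {0..t} ((\<lambda>s. S s x) \<circ> (+) h)"
    using assms by (intro integral_cong) (simp add: add_time)
  also have "\<dots> = integral {h..t + h} (\<lambda>s. S s x)"
    using integral_shift_Icc_real[of 0 t "\<lambda>s. S s x" h] by simp
  finally have 1: "S h (integral {0..t} (\<lambda>s. S s x)) = integral {h..t + h} (\<lambda>s. S s x)" .
  have 2: "integral {0..h} (\<lambda>s. S s x) + integral {h..t + h} (\<lambda>s. S s x) = integral {0..t + h} (\<lambda>s. S s x)"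
    using assms by (intro Henstock_Kurzweil_Integration.integral_combine integrable_on_orbit) auto
  have 3: "integral {0..t} (\<lambda>s. S s x) + integral {t..t + h} (\<lambda>s. S s x) = integral {0..t + h} (\<lambda>s. S s x)"
    using assms by (intro Henstock_Kurzweil_Integration.integral_combine integrable_on_orbit) auto
  show ?thesis using 1 2 3 by (simp add: algebra_simps)
qed

lemma tendsto_average:
  assumes "0 \<le> t"
  shows "((\<lambda>h. (1 / h) *\<^sub>R integral {t..t + h} (\<lambda>s. S s x)) \<longlongrightarrow> S t x) (at_right 0)"
proof (rule tendstoI)
  fix e :: real assume "e > 0"
  have "continuous (at t within {0..}) (\<lambda>s. S s x)"
    using continuous_on_orbit assms by (simp add: continuous_on_eq_continuous_within)
  then obtain d where "d > 0" and d: "\<And>s. s \<ge> 0 \<Longrightarrow> dist s t < d \<Longrightarrow> dist (S s x) (S t x) < e / 2"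
    unfolding continuous_within_eps_delta using \<open>e > 0\<close> by (meson atLeast_iff half_gt_zero)
  have "dist ((1 / h) *\<^sub>R integral {t..t + h} (\<lambda>s. S s x)) (S t x) < e" if h: "0 < h" "h < d" for h
  proof -
    have int: "(\<lambda>s. S s x) integrable_on {t..t + h}" by (rule integrable_on_orbit[OF assms])
    have "norm (integral {t..t + h} (\<lambda>s. S s x) - h *\<^sub>R S t x) \<le> e / 2 * measure lborel {t..t + h}"
    proof (rule has_integral_bound_real[of _ "{}" "\<lambda>s. S s x - S t x"])
      have "((\<lambda>s. S t x) has_integral h *\<^sub>R S t x) {t..t + h}"
        using has_integral_const_real[of "S t x" t "t + h"] h by simp
      then show "((\<lambda>s. S s x - S t x) has_integral integral {t..t + h} (\<lambda>s. S s x) - h *\<^sub>R S t x) {t..t + h}"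
        using int by (intro has_integral_diff integrable_integral)
      show "norm (S s x - S t x) \<le> e / 2" if "s \<in> {t..t + h} - {}" for s
        using d[of s] that h assms by (auto simp: dist_norm intro!: less_imp_le)
    qed (use \<open>e > 0\<close> in auto)
    then have le: "norm (integral {t..t + h} (\<lambda>s. S s x) - h *\<^sub>R S t x) \<le> e / 2 * h" using h by simp
    have "(1 / h) *\<^sub>R integral {t..t + h} (\<lambda>s. S s x) - S t x
        = (1 / h) *\<^sub>R (integral {t..t + h} (\<lambda>s. S s x) - h *\<^sub>R S t x)"
      using h by (simp add: scaleR_diff_right)
    then have "dist ((1 / h) *\<^sub>R integral {t..t + h} (\<lambda>s. S s x)) (S t x)
        = norm (integral {t..t + h} (\<lambda>s. S s x) - h *\<^sub>R S t x) / h"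
      using h by (simp add: dist_norm)
    also have "\<dots> \<le> e / 2" using le h by (simp add: pos_divide_le_eq)
    finally show ?thesis using \<open>e > 0\<close> by simp
  qed
  then show "\<forall>\<^sub>F h in at_right 0. dist ((1 / h) *\<^sub>R integral {t..t + h} (\<lambda>s. S s x)) (S t x) < e"
    using \<open>d > 0\<close> by (auto simp: eventually_at_right_field)
qed

lemma integral_orbit_in_generator:
  assumes "0 \<le> t"
  shows "(integral {0..t} (\<lambda>s. S s x), S t x - x) \<in> generator S"
proof -
  have "((\<lambda>h. (1 / h) *\<^sub>R integral {t..t + h} (\<lambda>s. S s x) - (1 / h) *\<^sub>R integral {0..0 + h} (\<lambda>s. S s x))
      \<longlongrightarrow> S t x - S 0 x) (at_right 0)"
    by (intro tendsto_diff tendsto_average assms) simp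
  moreover have "\<forall>\<^sub>F h in at_right 0.
      (1 / h) *\<^sub>R integral {t..t + h} (\<lambda>s. S s x) - (1 / h) *\<^sub>R integral {0..0 + h} (\<lambda>s. S s x)
      = (1 / h) *\<^sub>R (S h (integral {0..t} (\<lambda>s. S s x)) - integral {0..t} (\<lambda>s. S s x))"
    using eventually_at_right_less[of 0]
    by eventually_elim (use assms in \<open>simp add: integral_orbit_shift scaleR_diff_right\<close>)
  ultimately have "((\<lambda>h. (1 / h) *\<^sub>R (S h (integral {0..t} (\<lambda>s. S s x)) - integral {0..t} (\<lambda>s. S s x)))
      \<longlongrightarrow> S t x - S 0 x) (at_right 0)"
    by (rule Lim_transform_eventually)
  then show ?thesis by (simp add: generator_def zero_time)
qed

lemma norm_integral_orbit_le:
  assumes M: "\<And>s. s \<in> {a..b} \<Longrightarrow> norm (S s x) \<le> K" and "0 \<le> a" "a \<le> b"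
  shows "norm (integral {a..b} (\<lambda>s. S s x)) \<le> K * (b - a)"
proof -
  have "0 \<le> K" using M[of a] norm_ge_zero[of "S a x"] \<open>a \<le> b\<close> by (meson atLeastAtMost_iff order_refl order_trans)
  then have "norm (integral {a..b} (\<lambda>s. S s x)) \<le> K * measure lborel {a..b}"
    by (rule has_integral_bound_real[of _ "{}" "\<lambda>s. S s x"])
      (use M integrable_integral[OF integrable_on_orbit[OF \<open>0 \<le> a\<close>]] in auto)
  then show ?thesis using \<open>a \<le> b\<close> by simp
qed

lemma bounded_linear_integral_orbit:
  assumes "0 \<le> r"
  shows "bounded_linear (\<lambda>x. integral {0..r} (\<lambda>s. S s x))"
proof -
  obtain M where "M \<ge> 1" and M: "\<And>s y. s \<in> {0..r} \<Longrightarrow> norm (S s y) \<le> M * norm y"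
    by (rule bounded_on_interval[of r]) (rule that)
  show ?thesis
  proof (rule bounded_linear_intro[where K = "M * r"])
    fix x y and c :: real
    show "integral {0..r} (\<lambda>s. S s (x + y)) = integral {0..r} (\<lambda>s. S s x) + integral {0..r} (\<lambda>s. S s y)"
      by (subst Henstock_Kurzweil_Integration.integral_add[symmetric])
        (auto intro!: integrable_on_orbit integral_cong simp: linear_time)
    have "integral {0..r} (\<lambda>s. S s (c *\<^sub>R x)) = integral {0..r} (\<lambda>s. c *\<^sub>R S s x)"
      by (intro integral_cong) (simp add: linear_time)
    then show "integral {0..r} (\<lambda>s. S s (c *\<^sub>R x)) = c *\<^sub>R integral {0..r} (\<lambda>s. S s x)" by simp
    have "norm (integral {0..r} (\<lambda>s. S s x)) \<le> (M * norm x) * (r - 0)"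
      using M assms by (intro norm_integral_orbit_le) auto
    then show "norm (integral {0..r} (\<lambda>s. S s x)) \<le> norm x * (M * r)" by (simp add: mult_ac)
  qed
qed

end

text \<open>
  Strong continuity of the adjoint semigroup at \<open>0\<close>. The vectors on which it holds form a closed
  subspace \<open>Y\<close>, by local boundedness. With \<open>V r x = \<integral>\<^sub>0\<^sup>r S s x ds\<close>, every vector \<open>adjoint (V r) y\<close>
  lies in \<open>Y\<close>, because \<open>V r (S t x - x)\<close> is a difference of two integrals over intervals of length
  \<open>t\<close>. A vector \<open>x\<close> orthogonal to \<open>Y\<close> therefore satisfies \<open>V r x = 0\<close> for all \<open>r\<close>, and vanishes
  as the limit of \<open>V r x / r\<close>.
\<close>

lemma adjoint_C0_semigroup:
  fixes S :: "real \<Rightarrow> 'h \<Rightarrow> 'h::{real_inner, banach}"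
  assumes C0: "C0_semigroup S"
  shows "C0_semigroup (\<lambda>t. adjoint (S t))"
proof -
  interpret c0_semigroup S by standard fact
  let ?V = "\<lambda>r x. integral {0..r} (\<lambda>s. S s x)"
  obtain M where "M \<ge> 1" and M: "\<And>t x. t \<in> {0..2} \<Longrightarrow> norm (S t x) \<le> M * norm x"
    by (rule bounded_on_interval[of 2]) (rule that)
  have adj: "inner x (adjoint (S t) y) = inner (S t x) y" if "t \<ge> 0" for t x y
    by (simp add: inner_adjoint[OF bounded_linear[OF that]])
  have bl: "bounded_linear (adjoint (S t))" if "t \<ge> 0" for t
    by (rule bounded_linear_adjoint[OF bounded_linear[OF that]])
  have adjM: "norm (adjoint (S t) y) \<le> M * norm y" if "t \<in> {0..2}" for t y
    using that M \<open>M \<ge> 1\<close> by (intro norm_adjoint_le bounded_linear) auto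
  define Y where "Y = {y. ((\<lambda>t. adjoint (S t) y) \<longlongrightarrow> y) (at_right 0)}"
  have pos: "\<forall>\<^sub>F t in at_right (0::real). 0 < t \<and> t < 2"
    using eventually_at_right_field zero_less_numeral by blast
  have "subspace Y"
  proof (rule subspaceI)
    have "\<forall>\<^sub>F t in at_right 0. 0 = adjoint (S t) 0"
      using pos by eventually_elim (simp add: bl bounded_linear.linear linear_0)
    from Lim_transform_eventually[OF tendsto_const this] show "0 \<in> Y" by (simp add: Y_def)
    fix x y assume "x \<in> Y" "y \<in> Y"
    then have "((\<lambda>t. adjoint (S t) x + adjoint (S t) y) \<longlongrightarrow> x + y) (at_right 0)"
      unfolding Y_def by (intro tendsto_add) auto
    moreover have "\<forall>\<^sub>F t in at_right 0. adjoint (S t) x + adjoint (S t) y = adjoint (S t) (x + y)"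
      using pos by eventually_elim (simp add: bl bounded_linear.linear linear_add)
    ultimately have "((\<lambda>t. adjoint (S t) (x + y)) \<longlongrightarrow> x + y) (at_right 0)"
      by (rule Lim_transform_eventually)
    then show "x + y \<in> Y" by (simp add: Y_def)
  next
    fix c :: real and x assume "x \<in> Y"
    then have "((\<lambda>t. c *\<^sub>R adjoint (S t) x) \<longlongrightarrow> c *\<^sub>R x) (at_right 0)"
      unfolding Y_def by (intro tendsto_intros) auto
    moreover have "\<forall>\<^sub>F t in at_right 0. c *\<^sub>R adjoint (S t) x = adjoint (S t) (c *\<^sub>R x)"
      using pos by eventually_elim (simp add: bl bounded_linear.linear linear_scale)
    ultimately have "((\<lambda>t. adjoint (S t) (c *\<^sub>R x)) \<longlongrightarrow> c *\<^sub>R x) (at_right 0)"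
      by (rule Lim_transform_eventually)
    then show "c *\<^sub>R x \<in> Y" by (simp add: Y_def)
  qed
  moreover have "closed Y"
  proof (unfold closed_sequential_limits, intro allI impI, elim conjE)
    fix f y assume f: "\<forall>n. f n \<in> Y" and lim: "f \<longlonglongrightarrow> y"
    have "((\<lambda>t. adjoint (S t) y) \<longlongrightarrow> y) (at_right 0)"
    proof (rule tendstoI)
      fix e :: real assume "e > 0"
      then have e': "e / (2 * (M + 1)) > 0" using \<open>M \<ge> 1\<close> by simp
      from metric_LIMSEQ_D[OF lim e'] obtain n where n: "norm (f n - y) < e / (2 * (M + 1))"
        by (auto simp: dist_norm)
      then have n': "(M + 1) * norm (f n - y) < e / 2"
        using \<open>M \<ge> 1\<close> by (simp add: field_simps)
      have "\<forall>\<^sub>F t in at_right 0. dist (adjoint (S t) (f n)) (f n) < e / 2"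
        using f \<open>e > 0\<close> unfolding Y_def by (intro tendstoD) auto
      with pos show "\<forall>\<^sub>F t in at_right 0. dist (adjoint (S t) y) y < e"
      proof eventually_elim
        case (elim t)
        then have t: "t \<ge> 0" "t \<in> {0..2}" by auto
        have "adjoint (S t) y - y = (adjoint (S t) (f n) - f n) + ((f n - y) - adjoint (S t) (f n - y))"
          using bl[OF t(1)] by (simp add: bounded_linear.linear linear_diff)
        then have "norm (adjoint (S t) y - y)
            \<le> norm (adjoint (S t) (f n) - f n) + (norm (f n - y) + norm (adjoint (S t) (f n - y)))"
          using norm_triangle_ineq norm_triangle_ineq4
          by (metis (no_types, lifting) add_left_mono order_trans)
        also have "\<dots> \<le> norm (adjoint (S t) (f n) - f n) + (M + 1) * norm (f n - y)"
          using adjM[OF t(2), of "f n - y"] by (simp add: algebra_simps)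
        also have "\<dots> < e" using elim(2) n' by (simp add: dist_norm)
        finally show ?case by (simp add: dist_norm)
      qed
    qed
    then show "y \<in> Y" by (simp add: Y_def)
  qed
  moreover have "x = 0" if orth: "\<And>y. y \<in> Y \<Longrightarrow> inner x y = 0" for x
  proof -
    have inY: "adjoint (?V r) y \<in> Y" if r: "r \<in> {0<..1}" for r y
    proof -
      let ?z = "adjoint (?V r) y"
      have V: "inner v ?z = inner (?V r v) y" for v
        using inner_adjoint[OF bounded_linear_integral_orbit[of r]] r by simp
      have est: "norm (adjoint (S t) ?z - ?z) \<le> 2 * M * norm y * t" if t: "0 < t" "t < 1" for t
      proof -
        let ?d = "adjoint (S t) ?z - ?z"
        have Vd: "norm (?V r (S t v) - ?V r v) \<le> 2 * M * norm v * t" for v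
        proof -
          have "?V r (S t v) = S t (?V r v)"
          proof -
            have "S t (?V r v) = integral {0..r} (S t \<circ> (\<lambda>s. S s v))"
              by (rule integral_linear[symmetric, OF integrable_on_orbit bounded_linear]) (use t in auto)
            also have "\<dots> = ?V r (S t v)"
              using t by (intro integral_cong) (simp add: add_time[symmetric] add.commute)
            finally show ?thesis by simp
          qed
          then have "?V r (S t v) - ?V r v = integral {r..r + t} (\<lambda>s. S s v) - ?V t v"
            using integral_orbit_shift[of r t v] r t by simp
          also have "norm \<dots> \<le> norm (integral {r..r + t} (\<lambda>s. S s v)) + norm (?V t v)"
            by (rule norm_triangle_ineq4)
          also have "\<dots> \<le> (M * norm v) * (r + t - r) + (M * norm v) * (t - 0)"
            using r t by (intro add_mono norm_integral_orbit_le M) auto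
          finally show ?thesis by (simp add: algebra_simps)
        qed
        have "(norm ?d)\<^sup>2 = inner ?d (adjoint (S t) ?z) - inner ?d ?z"
          by (simp add: power2_norm_eq_inner inner_diff_right)
        also have "\<dots> = inner (?V r (S t ?d) - ?V r ?d) y"
          unfolding adj[OF less_imp_le[OF t(1)]] V inner_diff_left[of "?V r (S t ?d)"] ..
        also have "\<dots> \<le> norm (?V r (S t ?d) - ?V r ?d) * norm y" by (rule norm_cauchy_schwarz)
        also have "\<dots> \<le> (2 * M * norm ?d * t) * norm y" by (intro mult_right_mono Vd) auto
        finally have "norm ?d * norm ?d \<le> norm ?d * (2 * M * norm y * t)"
          by (simp add: power2_eq_square mult_ac)
        then show ?thesis
          using t \<open>M \<ge> 1\<close> by (cases "norm ?d = 0") (auto simp: mult_le_cancel_left)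
      qed
      have "((\<lambda>t. adjoint (S t) ?z - ?z) \<longlongrightarrow> 0) (at_right 0)"
      proof (rule Lim_null_comparison)
        show "\<forall>\<^sub>F t in at_right 0. norm (adjoint (S t) ?z - ?z) \<le> 2 * M * norm y * t"
          using est by (auto simp: eventually_at_right_field intro!: exI[of _ 1])
        have "((\<lambda>t. 2 * M * norm y * t) \<longlongrightarrow> 2 * M * norm y * 0) (at_right 0)"
          by (intro tendsto_intros)
        then show "((\<lambda>t. 2 * M * norm y * t) \<longlongrightarrow> 0) (at_right 0)" by simp
      qed
      from LIM_zero_cancel[OF this] show ?thesis by (simp add: Y_def)
    qed
    have "?V r x = 0" if r: "r \<in> {0<..1}" for r
    proof -
      have "inner (?V r x) y = 0" for y
        using orth[OF inY[OF r, of y]] inner_adjoint[OF bounded_linear_integral_orbit[of r]] r by simp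
      then show ?thesis using inner_eq_zero_iff by blast
    qed
    then have "\<forall>\<^sub>F r in at_right 0. (1 / r) *\<^sub>R integral {0..0 + r} (\<lambda>s. S s x) = 0"
      by (auto simp: eventually_at_right_field intro!: exI[of _ 1])
    from Lim_transform_eventually[OF tendsto_average[OF order_refl] this]
    have "((\<lambda>r::real. 0) \<longlongrightarrow> x) (at_right 0)" by (simp add: zero_time)
    then show "x = 0" using tendsto_unique[OF trivial_limit_at_right_real _ tendsto_const] by blast
  qed
  ultimately have "Y = UNIV" by (rule closed_subspace_eq_UNIV)
  have unique: "u = v" if "\<And>x. inner x u = inner x v" for u v :: 'h
    using that vector_eq_rdot by (metis inner_commute)
  show ?thesis
    unfolding C0_semigroup_def
  proof (intro conjI allI impI)
    show "bounded_linear (adjoint (S t))" if "0 \<le> t" for t by (rule bl[OF that])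
    show "adjoint (S 0) x = x" for x by (rule unique) (simp add: adj zero_time)
    show "adjoint (S (s + t)) x = adjoint (S s) (adjoint (S t) x)" if "0 \<le> s" "0 \<le> t" for s t x
    proof (rule unique)
      fix v
      have "S (s + t) v = S t (S s v)" using add_time[of t s v] that by (simp add: add.commute)
      then show "inner v (adjoint (S (s + t)) x) = inner v (adjoint (S s) (adjoint (S t) x))"
        using that by (simp add: adj)
    qed
    show "((\<lambda>t. adjoint (S t) x) \<longlongrightarrow> x) (at_right 0)" for x
      using \<open>Y = UNIV\<close> by (auto simp: Y_def)
  qed
qed

text \<open>
  For the harder inclusion let \<open>y\<close> be the value of the adjoint operator at \<open>x\<close>. Testing against
  \<open>\<integral>\<^sub>0\<^sup>t S s v ds\<close>, which lies in the domain of the generator, shows that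
  \<open>adjoint (S t) x - x = \<integral>\<^sub>0\<^sup>t adjoint (S s) y ds\<close>, and the derivative at \<open>0\<close> is \<open>y\<close> by strong continuity.
\<close>

lemma generator_adjoint:
  fixes S :: "real \<Rightarrow> 'h \<Rightarrow> 'h::{real_inner, banach}"
  assumes C0: "C0_semigroup S"
  shows "generator (\<lambda>t. adjoint (S t)) = adjoint_op (generator S)"
proof -
  interpret c0_semigroup S by standard fact
  interpret adj: c0_semigroup "\<lambda>t. adjoint (S t)" by standard (rule adjoint_C0_semigroup[OF C0])
  have adj: "inner x (adjoint (S t) y) = inner (S t x) y" if "t \<ge> 0" for t x y
    by (simp add: inner_adjoint[OF bounded_linear[OF that]])
  have pos: "\<forall>\<^sub>F t in at_right (0::real). 0 < t" by (rule eventually_at_right_less)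
  show ?thesis
  proof (rule set_eqI, clarify, intro iffI)
    fix x y assume "(x, y) \<in> generator (\<lambda>t. adjoint (S t))"
    then have lim: "((\<lambda>t. (1 / t) *\<^sub>R (adjoint (S t) x - x)) \<longlongrightarrow> y) (at_right 0)"
      by (simp add: generator_def)
    have "inner w x = inner v y" if "(v, w) \<in> generator S" for v w
    proof -
      have "((\<lambda>t. (1 / t) *\<^sub>R (S t v - v)) \<longlongrightarrow> w) (at_right 0)" using that by (simp add: generator_def)
      then have "((\<lambda>t. inner ((1 / t) *\<^sub>R (S t v - v)) x) \<longlongrightarrow> inner w x) (at_right 0)"
        by (intro tendsto_inner tendsto_const)
      moreover have "\<forall>\<^sub>F t in at_right 0. inner ((1 / t) *\<^sub>R (S t v - v)) x
          = inner v ((1 / t) *\<^sub>R (adjoint (S t) x - x))"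
        using pos by eventually_elim (simp add: inner_diff_left inner_diff_right adj)
      ultimately have "((\<lambda>t. inner v ((1 / t) *\<^sub>R (adjoint (S t) x - x))) \<longlongrightarrow> inner w x) (at_right 0)"
        by (rule Lim_transform_eventually)
      moreover have "((\<lambda>t. inner v ((1 / t) *\<^sub>R (adjoint (S t) x - x))) \<longlongrightarrow> inner v y) (at_right 0)"
        by (intro tendsto_inner tendsto_const lim)
      ultimately show ?thesis by (rule tendsto_unique[OF trivial_limit_at_right_real])
    qed
    then show "(x, y) \<in> adjoint_op (generator S)" by (auto simp: adjoint_op_def)
  next
    fix x y assume "(x, y) \<in> adjoint_op (generator S)"
    then have xy: "inner w x = inner v y" if "(v, w) \<in> generator S" for v w
      using that by (auto simp: adjoint_op_def)
    have formula: "adjoint (S t) x - x = integral {0..t} (\<lambda>s. adjoint (S s) y)" if t: "t \<ge> 0" for t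
    proof -
      have "inner v (adjoint (S t) x - x) = inner v (integral {0..t} (\<lambda>s. adjoint (S s) y))" for v
      proof -
        have "inner v (adjoint (S t) x - x) = inner (S t v - v) x"
          using t by (simp add: inner_diff_left inner_diff_right adj)
        also have "\<dots> = inner (integral {0..t} (\<lambda>s. S s v)) y"
          by (rule xy[OF integral_orbit_in_generator[OF t]])
        also have "\<dots> = integral {0..t} ((\<lambda>u. inner u y) \<circ> (\<lambda>s. S s v))"
          by (rule integral_linear[symmetric, OF integrable_on_orbit bounded_linear_inner_left]) simp
        also have "\<dots> = integral {0..t} ((\<lambda>u. inner v u) \<circ> (\<lambda>s. adjoint (S s) y))"
          by (intro integral_cong) (simp add: adj)
        also have "\<dots> = inner v (integral {0..t} (\<lambda>s. adjoint (S s) y))"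
          by (rule integral_linear[OF adj.integrable_on_orbit bounded_linear_inner_right]) simp
        finally show ?thesis .
      qed
      then show ?thesis using vector_eq_rdot by (metis inner_commute)
    qed
    have "((\<lambda>h. (1 / h) *\<^sub>R integral {0..0 + h} (\<lambda>s. adjoint (S s) y)) \<longlongrightarrow> y) (at_right 0)"
      using adj.tendsto_average[of 0 y] by (simp add: adj.zero_time)
    moreover have "\<forall>\<^sub>F h in at_right 0. (1 / h) *\<^sub>R integral {0..0 + h} (\<lambda>s. adjoint (S s) y)
        = (1 / h) *\<^sub>R (adjoint (S h) x - x)"
      using pos by eventually_elim (simp add: formula)
    ultimately have "((\<lambda>h. (1 / h) *\<^sub>R (adjoint (S h) x - x)) \<longlongrightarrow> y) (at_right 0)"
      by (rule Lim_transform_eventually)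
    then show "(x, y) \<in> generator (\<lambda>t. adjoint (S t))" by (simp add: generator_def)
  qed
qed

section \<open>Mild solutions\<close>

text \<open>
  The variation of constants formula as a function of time. A mild solution is determined by it on
  \<open>[0,T]\<close> only; choosing this representative makes solutions additive in the data.
\<close>

definition duhamel :: "(real \<Rightarrow> 'x \<Rightarrow> 'x::real_normed_vector) \<Rightarrow> (real \<Rightarrow> 'x) \<Rightarrow> 'x \<Rightarrow> real \<Rightarrow> 'x" where
  "duhamel S F x0 t = S t x0 + integral {0..t} (\<lambda>s. S (t - s) (F s))"

locale hilbert_semigroup = c0_semigroup S
  for S :: "real \<Rightarrow> 'h \<Rightarrow> 'h::{real_inner, banach}"
begin

text \<open>
  Semigroups have no meaningful values at negative times. This is why a time shift is composed with
  \<open>max 0\<close> below when its argument runs through all of \<open>[0,T]\<close>.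
\<close>

lemma L2_transport:
  assumes F: "F \<in> L2 T" and \<tau>: "continuous_on {0..T} \<tau>" "\<And>s. s \<in> {0..T} \<Longrightarrow> \<tau> s \<in> {0..R}"
  shows "(\<lambda>s. S (\<tau> s) (F s)) \<in> L2 T"
proof -
  obtain M where "M \<ge> 1" and M: "\<And>s y. s \<in> {0..R} \<Longrightarrow> norm (S s y) \<le> M * norm y"
    by (rule bounded_on_interval[of R]) (rule that)
  show ?thesis
  proof (rule L2_dominated[OF _ F F, of _ M 0])
    show "strongly_measurable (lebesgue_on {0..T}) (\<lambda>s. S (\<tau> s) (F s))"
    proof (rule strongly_measurable_caratheodory[OF L2_measurable[OF F], of "\<lambda>s x. S (\<tau> s) x"])
      fix s x d and X :: "nat \<Rightarrow> 'h"
      assume s: "s \<in> {0..T}" and d: "\<And>n::nat. d n \<in> {s..T}" "d \<longlonglongrightarrow> s" and X: "X \<longlonglongrightarrow> x"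
      have d': "d n \<in> {0..T}" for n using d(1)[of n] s by auto
      have "(\<lambda>n. \<tau> (d n)) \<longlonglongrightarrow> \<tau> s"
        using \<tau>(1) s d(2) d' unfolding continuous_on_sequentially by (auto simp: o_def)
      then show "(\<lambda>n. S (\<tau> (d n)) (X n)) \<longlonglongrightarrow> S (\<tau> s) x"
        using \<tau>(2)[OF d'] X by (intro tendsto_strong) auto
    qed
  qed (use M \<tau>(2) in auto)
qed

lemma L2_transport_backward:
  assumes "F \<in> L2 T" "t \<in> {0..T}"
  shows "(\<lambda>s. S (max 0 (t - s)) (F s)) \<in> L2 T"
  using assms by (intro L2_transport[where R = T] continuous_intros) auto

lemma L2_transport_forward:
  assumes "F \<in> L2 T" "s \<in> {0..T}"
  shows "(\<lambda>t. S (max 0 (t - s)) (F t)) \<in> L2 T"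
  using assms by (intro L2_transport[where R = T] continuous_intros) auto

lemma duhamel_integrable:
  assumes F: "F \<in> L2 T" and t: "t \<in> {0..T}" and "0 \<le> a" "b \<le> t"
  shows "(\<lambda>s. S (t - s) (F s)) integrable_on {a..b}"
proof -
  have "(\<lambda>s. S (max 0 (t - s)) (F s)) integrable_on {0..T}"
    using t by (intro L2_integrable_on L2_transport_backward F) auto
  then have "(\<lambda>s. S (max 0 (t - s)) (F s)) integrable_on {a..b}"
    by (rule integrable_subinterval_real) (use assms in auto)
  then show ?thesis by (rule integrable_eq) (use assms in auto)
qed

lemma norm_integrable_on: "F \<in> L2 T \<Longrightarrow> (\<lambda>s. norm (F s)) integrable_on {0..T}"
  by (intro integrable_on_lebesgue_on integrable_L2_norm) auto

lemma norm_duhamel_integral_le: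
  assumes F: "F \<in> L2 T" and t: "t \<in> {0..T}" and ab: "0 \<le> a" "b \<le> t"
    and M: "\<And>s y. s \<in> {0..T} \<Longrightarrow> norm (S s y) \<le> M * norm y"
  shows "norm (integral {a..b} (\<lambda>s. S (t - s) (F s))) \<le> M * integral {a..b} (\<lambda>s. norm (F s))"
proof -
  have "(\<lambda>s. norm (F s)) integrable_on {a..b}"
    using norm_integrable_on[OF F] by (rule integrable_subinterval_real) (use t ab in auto)
  then have "(\<lambda>s. M * norm (F s)) integrable_on {a..b}" by (rule integrable_on_mult_right)
  then have "norm (integral {a..b} (\<lambda>s. S (t - s) (F s))) \<le> integral {a..b} (\<lambda>s. M * norm (F s))"
    using t ab
    by (intro Henstock_Kurzweil_Integration.integral_norm_bound_integral duhamel_integrable[OF F t] M) auto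
  then show ?thesis by simp
qed

lemma integral_norm_le_L2:
  assumes F: "F \<in> L2 T" and t: "t \<in> {0..T}"
  shows "integral {0..t} (\<lambda>s. norm (F s)) \<le> sqrt T * L2_norm T F"
proof -
  have "integral {0..t} (\<lambda>s. norm (F s)) \<le> integral {0..T} (\<lambda>s. norm (F s))"
  proof (rule integral_subset_le)
    show "(\<lambda>s. norm (F s)) integrable_on {0..t}"
      using norm_integrable_on[OF F] by (rule integrable_subinterval_real) (use t in auto)
  qed (use t norm_integrable_on[OF F] in auto)
  also have "\<dots> = (\<integral>s. norm (F s) \<partial>lebesgue_on {0..T})"
    by (intro lebesgue_integral_eq_integral[symmetric] integrable_L2_norm F) simp
  also have "\<dots> \<le> sqrt T * L2_norm T F" using t by (intro L1_le_L2 F) auto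
  finally show ?thesis .
qed

lemma norm_duhamel_le:
  assumes F: "F \<in> L2 T" and t: "t \<in> {0..T}" and "M \<ge> 0"
    and M: "\<And>s y. s \<in> {0..T} \<Longrightarrow> norm (S s y) \<le> M * norm y"
  shows "norm (duhamel S F x0 t) \<le> M * norm x0 + M * (sqrt T * L2_norm T F)"
proof -
  have "norm (duhamel S F x0 t) \<le> norm (S t x0) + norm (integral {0..t} (\<lambda>s. S (t - s) (F s)))"
    unfolding duhamel_def by (rule norm_triangle_ineq)
  also have "\<dots> \<le> M * norm x0 + M * integral {0..t} (\<lambda>s. norm (F s))"
    by (intro add_mono M t norm_duhamel_integral_le[OF F t] order_refl) auto
  also have "\<dots> \<le> M * norm x0 + M * (sqrt T * L2_norm T F)"
    using \<open>M \<ge> 0\<close> by (intro add_left_mono mult_left_mono integral_norm_le_L2[OF F t])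
  finally show ?thesis .
qed

lemma duhamel_step:
  assumes F: "F \<in> L2 T" and "0 \<le> s" "s \<le> t" "t \<le> T"
  shows "duhamel S F x0 t = S (t - s) (duhamel S F x0 s) + integral {s..t} (\<lambda>r. S (t - r) (F r))"
proof -
  have st: "s \<in> {0..T}" "t \<in> {0..T}" "0 \<le> t - s" using assms by auto
  have "integral {0..t} (\<lambda>r. S (t - r) (F r))
      = integral {0..s} (\<lambda>r. S (t - r) (F r)) + integral {s..t} (\<lambda>r. S (t - r) (F r))"
    using assms by (intro Henstock_Kurzweil_Integration.integral_combine[symmetric] duhamel_integrable[OF F]) auto
  also have "integral {0..s} (\<lambda>r. S (t - r) (F r)) = integral {0..s} (S (t - s) \<circ> (\<lambda>r. S (s - r) (F r)))"
    using st by (intro integral_cong) (simp add: add_time[symmetric])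
  also have "\<dots> = S (t - s) (integral {0..s} (\<lambda>r. S (s - r) (F r)))"
    by (rule integral_linear[OF duhamel_integrable[OF F st(1)] bounded_linear[OF st(3)]]) auto
  finally show ?thesis
    using st(3) add_time[of "t - s" s x0] \<open>0 \<le> s\<close> by (simp add: duhamel_def linear_time)
qed

text \<open>
  Approaching from the right, the formula can be restarted at the fixed time \<open>s\<close> from the fixed vector
  \<open>duhamel S F x0 s\<close>, so strong continuity at time \<open>0\<close> suffices. Right continuity is all that
  \<open>strongly_measurable_caratheodory\<close> needs for the measurability of the solution.
\<close>

lemma duhamel_right_continuous:
  assumes F: "F \<in> L2 T" and s: "s \<in> {0..T}" and d: "\<And>n::nat. d n \<in> {s..T}" "d \<longlonglongrightarrow> s"
  shows "(\<lambda>n. duhamel S F x0 (d n)) \<longlonglongrightarrow> duhamel S F x0 s"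
proof -
  let ?N = "\<lambda>t. integral {0..t} (\<lambda>r. norm (F r))"
  obtain M where "M \<ge> 1" and M: "\<And>s y. s \<in> {0..T} \<Longrightarrow> norm (S s y) \<le> M * norm y"
    by (rule bounded_on_interval[of T]) (rule that)
  have d': "d n \<in> {0..T}" "s \<le> d n" "d n \<le> T" for n using d(1)[of n] s by auto
  have "continuous_on {0..T} ?N"
    by (rule indefinite_integral_continuous_1[OF norm_integrable_on[OF F]])
  then have N: "(\<lambda>n. ?N (d n)) \<longlonglongrightarrow> ?N s"
    unfolding continuous_on_sequentially using d' d(2) s by (auto simp: o_def)
  have "(\<lambda>n. integral {s..d n} (\<lambda>r. S (d n - r) (F r))) \<longlonglongrightarrow> 0"
  proof (rule Lim_null_comparison[OF always_eventually[OF allI]])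
    fix n
    have "norm (integral {s..d n} (\<lambda>r. S (d n - r) (F r))) \<le> M * integral {s..d n} (\<lambda>r. norm (F r))"
      using s by (intro norm_duhamel_integral_le[OF F d'(1)] M) auto
    also have "integral {s..d n} (\<lambda>r. norm (F r)) = ?N (d n) - ?N s"
    proof -
      have "(\<lambda>r. norm (F r)) integrable_on {0..d n}"
        using norm_integrable_on[OF F] by (rule integrable_subinterval_real) (use d' in auto)
      then have "?N s + integral {s..d n} (\<lambda>r. norm (F r)) = ?N (d n)"
        using s d' by (intro Henstock_Kurzweil_Integration.integral_combine) auto
      then show ?thesis by simp
    qed
    finally show "norm (integral {s..d n} (\<lambda>r. S (d n - r) (F r))) \<le> M * (?N (d n) - ?N s)" .
  next
    have "(\<lambda>n. M * (?N (d n) - ?N s)) \<longlonglongrightarrow> M * (?N s - ?N s)"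
      by (intro tendsto_mult tendsto_diff tendsto_const N)
    then show "(\<lambda>n. M * (?N (d n) - ?N s)) \<longlonglongrightarrow> 0" by simp
  qed
  moreover have "(\<lambda>n. S (d n - s) (duhamel S F x0 s)) \<longlonglongrightarrow> S 0 (duhamel S F x0 s)"
    using d'(2) LIM_zero[OF d(2)] by (intro tendsto_strong tendsto_const) auto
  ultimately have "(\<lambda>n. S (d n - s) (duhamel S F x0 s) + integral {s..d n} (\<lambda>r. S (d n - r) (F r)))
      \<longlonglongrightarrow> S 0 (duhamel S F x0 s) + 0" by (intro tendsto_add)
  then show ?thesis
    using duhamel_step[OF F _ d'(2,3)] s by (simp add: zero_time)
qed

lemma L2_duhamel:
  assumes F: "F \<in> L2 T"
  shows "duhamel S F x0 \<in> L2 T"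
proof -
  obtain M where "M \<ge> 1" and M: "\<And>s y. s \<in> {0..T} \<Longrightarrow> norm (S s y) \<le> M * norm y"
    by (rule bounded_on_interval[of T]) (rule that)
  have "strongly_measurable (lebesgue_on {0..T}) (duhamel S F x0)"
    by (rule strongly_measurable_caratheodory[OF L2_measurable[OF F], where \<phi> = "\<lambda>s x. duhamel S F x0 s"])
      (rule duhamel_right_continuous[OF F])
  then show ?thesis
    using norm_duhamel_le[OF F _ _ M] \<open>M \<ge> 1\<close>
    by (intro L2_bounded[of T _ "M * norm x0 + M * (sqrt T * L2_norm T F)"]) auto
qed

lemma duhamel_add:
  assumes "F \<in> L2 T" "G \<in> L2 T" "t \<in> {0..T}"
  shows "duhamel S (\<lambda>s. F s + G s) (x + y) t = duhamel S F x t + duhamel S G y t"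
proof -
  have "integral {0..t} (\<lambda>s. S (t - s) (F s + G s))
      = integral {0..t} (\<lambda>s. S (t - s) (F s) + S (t - s) (G s))"
    by (intro integral_cong) (simp add: linear_time)
  also have "\<dots> = integral {0..t} (\<lambda>s. S (t - s) (F s)) + integral {0..t} (\<lambda>s. S (t - s) (G s))"
    by (intro Henstock_Kurzweil_Integration.integral_add duhamel_integrable[OF assms(1,3)]
        duhamel_integrable[OF assms(2,3)]) auto
  finally show ?thesis using assms(3) by (simp add: duhamel_def linear_time)
qed

lemma duhamel_scaleR:
  assumes "t \<ge> 0"
  shows "duhamel S (\<lambda>s. c *\<^sub>R F s) (c *\<^sub>R x) t = c *\<^sub>R duhamel S F x t"
proof -
  have "integral {0..t} (\<lambda>s. S (t - s) (c *\<^sub>R F s)) = integral {0..t} (\<lambda>s. c *\<^sub>R S (t - s) (F s))"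
    by (intro integral_cong) (simp add: linear_time)
  then show ?thesis using assms by (simp add: duhamel_def linear_time scaleR_add_right)
qed

lemma mild_solution_duhamel:
  assumes A: "A = generator S" and F: "F \<in> L2 T"
  shows "mild_solution A T F x0 (duhamel S F x0)"
  unfolding mild_solution_def
proof (intro exI[of _ S] conjI ballI)
  show "generates A S" using A C0 by (simp add: generates_def)
  fix t assume t: "t \<in> {0..T}"
  show "((\<lambda>s. S (t - s) (F s)) has_integral (duhamel S F x0 t - S t x0)) {0..t}"
    using integrable_integral[OF duhamel_integrable[OF F t, of 0 t]] by (simp add: duhamel_def)
qed

lemma duhamel_AE:
  assumes ae: "AE s in lebesgue_on {0..T}. F s = F' s" and t: "t \<in> {0..T}"
  shows "duhamel S F x0 t = duhamel S F' x0 t"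
proof -
  obtain N where N: "{s \<in> {0..T}. F s \<noteq> F' s} \<subseteq> N" "N \<in> null_sets (lebesgue_on {0..T})"
    using ae by (auto simp: eventually_ae_filter)
  then have "negligible N" by (simp add: null_sets_restrict_space negligible_iff_null_sets)
  then have "integral {0..t} (\<lambda>s. S (t - s) (F s)) = integral {0..t} (\<lambda>s. S (t - s) (F' s))"
    by (rule integral_spike) (use N(1) t in force)
  then show ?thesis by (simp add: duhamel_def)
qed

end

section \<open>Duality between the forward and the backward equation\<close>

lemma has_integral_reflection:
  assumes "(h has_integral i) {s..T::real}"
  shows "((\<lambda>r. h (T - r)) has_integral i) {0..T - s}"
proof -
  have "((\<lambda>r. h ((-1) *\<^sub>R r + T)) has_integral (1 / \<bar>-1\<bar> ^ DIM(real)) *\<^sub>R i)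
      ((\<lambda>x. (1 / (-1)) *\<^sub>R x + - ((1 / (-1)) *\<^sub>R T)) ` cbox s T)"
    by (rule has_integral_affinity) (use assms in auto)
  moreover have "(\<lambda>x. (1 / (-1)) *\<^sub>R x + - ((1 / (-1)) *\<^sub>R T)) ` cbox s T = {0..T - s}"
    by (auto simp: image_iff intro!: bexI[of _ "T - _"])
  ultimately show ?thesis by simp
qed

lemma L2_inner_AE:
  assumes "f \<in> L2 T" "f' \<in> L2 T" "g \<in> L2 T" and ae: "AE t in lebesgue_on {0..T}. f' t = f t"
  shows "L2_inner T f' g = L2_inner T f g"
  unfolding L2_inner_def
proof (rule integral_cong_AE)
  show "AE t in lebesgue_on {0..T}. inner (f' t) (g t) = inner (f t) (g t)"
    using ae by eventually_elim simp
qed (use assms in \<open>auto intro: borel_measurable_integrable integrable_L2_inner\<close>)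

lemma L2_inner_cong:
  assumes "\<And>t. t \<in> {0..T} \<Longrightarrow> inner (f t) (g t) = inner (f' t) (g' t)"
  shows "L2_inner T f g = L2_inner T f' g'"
  unfolding L2_inner_def using assms by (intro Bochner_Integration.integral_cong) auto

lemma L2_cutoff:
  assumes g: "g \<in> L2 T" and A: "A \<in> sets (lebesgue_on {0..T})"
  shows "(\<lambda>t. if t \<in> A then g t else 0) \<in> L2 T"
proof (rule L2_dominated[OF _ g g, of _ 1 0])
  have "strongly_measurable (lebesgue_on {0..T}) (\<lambda>t. indicat_real A t *\<^sub>R g t)"
    using strongly_measurable_simple[OF simple_function_indicator[OF A]] L2_measurable[OF g]
    by (rule strongly_measurable_compose2[where h = "(*\<^sub>R)"]) (rule tendsto_scaleR)
  moreover have "indicat_real A t *\<^sub>R g t = (if t \<in> A then g t else 0)" for t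
    by (simp add: indicator_def)
  ultimately show "strongly_measurable (lebesgue_on {0..T}) (\<lambda>t. if t \<in> A then g t else 0)" by simp
qed auto

lemma inner_integral_L2:
  fixes g :: "real \<Rightarrow> 'h::{real_inner, banach}"
  assumes "T \<ge> 0" "g \<in> L2 T"
  shows "inner (integral {0..T} g) c = (\<integral>t. inner (g t) c \<partial>lebesgue_on {0..T})"
proof -
  have "inner (integral {0..T} g) c = integral {0..T} ((\<lambda>u. inner u c) \<circ> g)"
    by (rule integral_linear[symmetric, OF L2_integrable_on[OF assms] bounded_linear_inner_left])
  also have "\<dots> = (\<integral>t. inner (g t) c \<partial>lebesgue_on {0..T})"
    unfolding o_def
    by (intro lebesgue_integral_eq_integral[symmetric] integrable_L2_inner L2_const assms) simp
  finally show ?thesis .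
qed

lemma simple_function_measurable_image:
  assumes s: "simple_function M s"
  shows "s \<in> measurable M (count_space (s ` space M))"
  using simple_functionD(2)[OF s] by (auto simp: measurable_def)

context hilbert_semigroup
begin

text \<open>
  Exchanging the order of integration over the triangle \<open>0 \<le> s \<le> t \<le> T\<close>. Joint measurability of the
  kernel is only clear when \<open>F\<close> and \<open>f\<close> are everywhere limits of simple functions, hence both are
  first modified on a null set.
\<close>

lemma volterra_duality:
  assumes "T \<ge> 0" and F: "F \<in> L2 T" and f: "f \<in> L2 T"
  shows "L2_inner T (duhamel S F 0) f
    = L2_inner T F (\<lambda>s. duhamel (\<lambda>t. adjoint (S t)) (\<lambda>r. f (T - r)) 0 (T - s))"
proof -
  let ?M = "lebesgue_on {0..T}" and ?Sa = "\<lambda>t. adjoint (S t)"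
  interpret adj: hilbert_semigroup ?Sa
    by standard (rule adjoint_C0_semigroup[OF C0])
  have adj: "inner x (adjoint (S t) y) = inner (S t x) y" if "t \<ge> 0" for t x y
    by (simp add: inner_adjoint[OF bounded_linear[OF that]])
  obtain Fn F' where Fn: "\<And>n::nat. simple_function ?M (Fn n)"
    and Flim: "\<And>t. t \<in> space ?M \<Longrightarrow> (\<lambda>n. Fn n t) \<longlonglongrightarrow> F' t" and Fae: "AE t in ?M. F' t = F t"
    by (rule strongly_measurable_everywhere[OF L2_measurable[OF F]]) (rule that)
  obtain fn f' where fn: "\<And>n::nat. simple_function ?M (fn n)"
    and flim: "\<And>t. t \<in> space ?M \<Longrightarrow> (\<lambda>n. fn n t) \<longlonglongrightarrow> f' t" and fae: "AE t in ?M. f' t = f t"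
    by (rule strongly_measurable_everywhere[OF L2_measurable[OF f]]) (rule that)
  have F': "F' \<in> L2 T"
    by (rule L2_AE(1)[OF _ F Fae]) (use Fn Flim in \<open>auto simp: strongly_measurable_def intro!: exI[of _ Fn]\<close>)
  have f': "f' \<in> L2 T"
    by (rule L2_AE(1)[OF _ f fae]) (use fn flim in \<open>auto simp: strongly_measurable_def intro!: exI[of _ fn]\<close>)
  have reflected: "(\<lambda>r. f (T - r)) \<in> L2 T" "(\<lambda>r. f' (T - r)) \<in> L2 T" using f f' by (auto intro: L2_reflection)
  have refl_ae: "AE r in ?M. f (T - r) = f' (T - r)"
  proof (rule AE_distrD[OF reflection_measurable])
    show "AE t in distr ?M ?M (\<lambda>t. T - t). f t = f' t"
      unfolding distr_reflection using fae by eventually_elim simp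
  qed
  define K where "K s t = (if s \<le> t then inner (S (max 0 (t - s)) (F' s)) (f' t) else 0)" for s t
  define Z where "Z f s = duhamel ?Sa (\<lambda>r. f (T - r)) 0 (T - s)" for f s
  have Z: "Z f \<in> L2 T" unfolding Z_def by (intro L2_reflection adj.L2_duhamel reflected)
  have row: "(\<integral>s. K s t \<partial>?M) = inner (duhamel S F' 0 t) (f' t)" if t: "t \<in> {0..T}" for t
  proof -
    let ?g = "\<lambda>s. if s \<in> {0..t} then S (max 0 (t - s)) (F' s) else 0"
    have g: "?g \<in> L2 T"
      using t by (intro L2_cutoff L2_transport_backward F') (auto simp: sets_restrict_space_iff)
    have "integral {0..T} ?g = integral {0..t} (\<lambda>s. S (max 0 (t - s)) (F' s))"
      using t by (subst Henstock_Kurzweil_Integration.integral_restrict_Int) (simp add: Int_absorb2)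
    also have "\<dots> = duhamel S F' 0 t"
      using t by (auto simp: duhamel_def linear_time intro!: integral_cong)
    finally have "inner (duhamel S F' 0 t) (f' t) = (\<integral>s. inner (?g s) (f' t) \<partial>?M)"
      using inner_integral_L2[OF \<open>T \<ge> 0\<close> g] by simp
    also have "\<dots> = (\<integral>s. K s t \<partial>?M)"
      by (intro Bochner_Integration.integral_cong) (auto simp: K_def)
    finally show ?thesis by simp
  qed
  have col: "integrable ?M (K s)" "(\<integral>t. K s t \<partial>?M) = inner (F' s) (Z f' s)" if s: "s \<in> {0..T}" for s
  proof -
    let ?g = "\<lambda>t. if t \<in> {s..T} then ?Sa (max 0 (t - s)) (f' t) else 0"
    have g: "?g \<in> L2 T"
      using s by (intro L2_cutoff adj.L2_transport_forward f') (auto simp: sets_restrict_space_iff)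
    have gK: "inner (?g t) (F' s) = K s t" if "t \<in> {0..T}" for t
      using that by (auto simp: K_def adj inner_commute[of _ "F' s"])
    have "integrable ?M (\<lambda>t. inner (?g t) (F' s)) \<longleftrightarrow> integrable ?M (K s)"
      by (rule Bochner_Integration.integrable_cong[OF refl gK]) simp
    then show "integrable ?M (K s)" using integrable_L2_inner[OF g L2_const[of "F' s"]] by simp
    have int: "(\<lambda>t. ?Sa (max 0 (t - s)) (f' t)) integrable_on {s..T}"
      by (rule integrable_subinterval_real[OF L2_integrable_on[OF \<open>T \<ge> 0\<close> adj.L2_transport_forward[OF f' s]]])
        (use s in auto)
    have "integral {0..T} ?g = integral {s..T} (\<lambda>t. ?Sa (max 0 (t - s)) (f' t))"
      using s by (subst Henstock_Kurzweil_Integration.integral_restrict_Int) (simp add: Int_absorb2)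
    also have "\<dots> = integral {0..T - s} (\<lambda>r. ?Sa (max 0 (T - r - s)) (f' (T - r)))"
      using has_integral_reflection[OF integrable_integral[OF int]] by (simp add: integral_unique)
    also have "\<dots> = Z f' s"
      using s by (auto simp: Z_def duhamel_def adj.linear_time algebra_simps intro!: integral_cong)
    finally have "inner (Z f' s) (F' s) = (\<integral>t. inner (?g t) (F' s) \<partial>?M)"
      using inner_integral_L2[OF \<open>T \<ge> 0\<close> g] by simp
    also have "\<dots> = (\<integral>t. K s t \<partial>?M)"
      by (rule Bochner_Integration.integral_cong[OF refl gK]) simp
    finally show "(\<integral>t. K s t \<partial>?M) = inner (F' s) (Z f' s)" by (simp add: inner_commute)
  qed
  interpret finite_measure ?M by (rule finite_measure_interval)
  interpret pair_sigma_finite ?M ?M ..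
  have id: "(\<lambda>x. x) \<in> borel_measurable ?M" using id_borel_measurable_lebesgue_on by (simp add: id_def)
  have fst_snd: "fst \<in> borel_measurable (?M \<Otimes>\<^sub>M ?M)" "snd \<in> borel_measurable (?M \<Otimes>\<^sub>M ?M)"
    by (rule measurable_compose[OF measurable_fst id], rule measurable_compose[OF measurable_snd id])
  have meas: "case_prod K \<in> borel_measurable (?M \<Otimes>\<^sub>M ?M)"
  proof (rule borel_measurable_LIMSEQ_real)
    let ?q = "\<lambda>a b p. if fst p \<le> snd p then inner (S (max 0 (snd p - fst p)) a) b else 0"
    fix p assume "p \<in> space (?M \<Otimes>\<^sub>M ?M)"
    then have "fst p \<in> space ?M" "snd p \<in> space ?M" by (auto simp: space_pair_measure)
    then have "(\<lambda>n. inner (S (max 0 (snd p - fst p)) (Fn n (fst p))) (fn n (snd p)))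
        \<longlonglongrightarrow> inner (S (max 0 (snd p - fst p)) (F' (fst p))) (f' (snd p))"
      by (intro tendsto_inner tendsto_strong Flim flim tendsto_const) auto
    then show "(\<lambda>n. ?q (Fn n (fst p)) (fn n (snd p)) p) \<longlonglongrightarrow> case_prod K p"
      by (cases "fst p \<le> snd p") (simp_all add: K_def case_prod_unfold)
  next
    let ?q = "\<lambda>a b p. if fst p \<le> snd p then inner (S (max 0 (snd p - fst p)) a) b else 0"
    fix n
    have q: "?q a b \<in> borel_measurable (?M \<Otimes>\<^sub>M ?M)" for a b
    proof -
      have "continuous_on UNIV (\<lambda>r. inner (S (max 0 r) a) b)"
        by (intro continuous_on_inner continuous_on_const continuous_on_compose2[OF continuous_on_orbit]
            continuous_on_max continuous_on_id) auto
      then have "(\<lambda>r. inner (S (max 0 r) a) b) \<in> borel_measurable borel"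
        by (rule borel_measurable_continuous_onI)
      from measurable_compose[OF borel_measurable_diff[OF fst_snd(2,1)] this] fst_snd
      show ?thesis by measurable
    qed
    have c1: "(\<lambda>p. Fn n (fst p)) \<in> measurable (?M \<Otimes>\<^sub>M ?M) (count_space (Fn n ` space ?M))"
      by (rule measurable_compose[OF measurable_fst simple_function_measurable_image[OF Fn]])
    have c2: "(\<lambda>p. fn n (snd p)) \<in> measurable (?M \<Otimes>\<^sub>M ?M) (count_space (fn n ` space ?M))"
      by (rule measurable_compose[OF measurable_snd simple_function_measurable_image[OF fn]])
    show "(\<lambda>p. ?q (Fn n (fst p)) (fn n (snd p)) p) \<in> borel_measurable (?M \<Otimes>\<^sub>M ?M)"
      by (rule measurable_compose_countable'[OF measurable_compose_countable'[OF q c1] c2])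
        (auto intro!: countable_finite simple_functionD(1)[OF Fn, simplified] simple_functionD(1)[OF fn, simplified])
  qed
  obtain M where "M \<ge> 1" and M: "\<And>s y. s \<in> {0..T} \<Longrightarrow> norm (S s y) \<le> M * norm y"
    by (rule bounded_on_interval[of T]) (rule that)
  have "integrable (?M \<Otimes>\<^sub>M ?M) (case_prod K)"
  proof (rule Fubini_integrable[OF meas])
    let ?c = "M * (\<integral>t. norm (f' t) \<partial>?M)"
    have "0 \<le> ?c" using \<open>M \<ge> 1\<close> by (intro mult_nonneg_nonneg integral_nonneg_AE) auto
    show "integrable ?M (\<lambda>s. \<integral>t. norm (case_prod K (s, t)) \<partial>?M)"
    proof (rule Bochner_Integration.integrable_bound)
      show "integrable ?M (\<lambda>s. ?c * norm (F' s))" using integrable_L2_norm[OF F'] by simp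
      have "case_prod (\<lambda>s t. norm (K s t)) \<in> borel_measurable (?M \<Otimes>\<^sub>M ?M)"
        using measurable_compose[OF meas borel_measurable_norm] by (simp add: case_prod_unfold)
      then show "(\<lambda>s. \<integral>t. norm (case_prod K (s, t)) \<partial>?M) \<in> borel_measurable ?M"
        using borel_measurable_lebesgue_integral by simp
      show "AE s in ?M. norm (\<integral>t. norm (case_prod K (s, t)) \<partial>?M) \<le> norm (?c * norm (F' s))"
      proof (rule AE_I2)
        fix s assume "s \<in> space ?M"
        then have s: "s \<in> {0..T}" by simp
        have "(\<integral>t. norm (K s t) \<partial>?M) \<le> (\<integral>t. M * norm (F' s) * norm (f' t) \<partial>?M)"
        proof (rule integral_mono)
          fix t assume "t \<in> space ?M"
          then have t: "max 0 (t - s) \<in> {0..T}" using s by auto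
          have "norm (K s t) \<le> norm (S (max 0 (t - s)) (F' s)) * norm (f' t)"
            using Cauchy_Schwarz_ineq2 by (auto simp: K_def)
          also have "\<dots> \<le> M * norm (F' s) * norm (f' t)" by (intro mult_right_mono M t) auto
          finally show "norm (K s t) \<le> M * norm (F' s) * norm (f' t)" .
        qed (use col(1)[OF s] integrable_L2_norm[OF f'] in auto)
        then show "norm (\<integral>t. norm (case_prod K (s, t)) \<partial>?M) \<le> norm (?c * norm (F' s))"
          using \<open>0 \<le> ?c\<close> by (simp add: mult_ac)
      qed
    qed
    show "AE s in ?M. integrable ?M (\<lambda>t. case_prod K (s, t))" using col(1) by (intro AE_I2) simp
  qed
  then have fubini: "(\<integral>t. (\<integral>s. K s t \<partial>?M) \<partial>?M) = (\<integral>s. (\<integral>t. K s t \<partial>?M) \<partial>?M)"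
    by (rule Fubini_integral)
  have "L2_inner T (duhamel S F 0) f = L2_inner T (duhamel S F 0) f'"
    using L2_inner_AE[OF f f' L2_duhamel[OF F] fae] by (simp add: L2_inner_commute)
  also have "\<dots> = L2_inner T (duhamel S F' 0) f'"
    by (intro L2_inner_cong) (simp add: duhamel_AE[OF Fae])
  also have "\<dots> = (\<integral>t. (\<integral>s. K s t \<partial>?M) \<partial>?M)"
    unfolding L2_inner_def by (intro Bochner_Integration.integral_cong) (auto simp: row)
  also have "\<dots> = (\<integral>s. (\<integral>t. K s t \<partial>?M) \<partial>?M)" by (rule fubini)
  also have "\<dots> = L2_inner T F' (Z f')"
    unfolding L2_inner_def by (intro Bochner_Integration.integral_cong) (auto simp: col(2))
  also have "\<dots> = L2_inner T F' (Z f)"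
    by (intro L2_inner_cong) (simp add: Z_def adj.duhamel_AE[OF refl_ae])
  also have "\<dots> = L2_inner T F (Z f)" by (rule L2_inner_AE[OF F F' Z Fae])
  finally show ?thesis by (simp add: Z_def[abs_def])
qed

text \<open>
  Integration by parts for mild solutions, which need not be differentiable: the contributions of the
  initial data match by the definition of the adjoint semigroup, and the two double integrals match
  by \<open>volterra_duality\<close>.
\<close>

lemma duality:
  fixes y0 zT :: 'h
  assumes "T \<ge> 0" and F: "F \<in> L2 T" and f: "f \<in> L2 T"
  defines "y \<equiv> duhamel S F y0"
    and "z \<equiv> \<lambda>s. duhamel (\<lambda>t. adjoint (S t)) (\<lambda>r. - f (T - r)) zT (T - s)"
  shows "inner (y T) zT - inner y0 (z 0) = L2_inner T F z + L2_inner T y f"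
proof -
  let ?Sa = "\<lambda>t. adjoint (S t)"
  interpret adj: hilbert_semigroup ?Sa
    by standard (rule adjoint_C0_semigroup[OF C0])
  have adj: "inner x (adjoint (S t) y) = inner (S t x) y" if "t \<ge> 0" for t x y
    by (simp add: inner_adjoint[OF bounded_linear[OF that]])
  define Z where "Z s = duhamel ?Sa (\<lambda>r. f (T - r)) 0 (T - s)" for s
  have Z: "Z \<in> L2 T" unfolding Z_def by (intro L2_reflection adj.L2_duhamel f)
  have p: "(\<lambda>s. ?Sa (T - s) zT) \<in> L2 T"
    by (rule adj.L2_transport[OF L2_const, where R = T]) (auto intro!: continuous_intros)
  have q: "(\<lambda>t. S t y0) \<in> L2 T"
    by (rule L2_transport[OF L2_const, where R = T]) (auto intro!: continuous_intros)
  have z: "z s = ?Sa (T - s) zT - Z s" if "s \<in> {0..T}" for s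
  proof -
    have "integral {0..T - s} (\<lambda>r. ?Sa (T - s - r) (- f (T - r)))
        = integral {0..T - s} (\<lambda>r. - ?Sa (T - s - r) (f (T - r)))"
      by (intro integral_cong) (simp add: adj.linear_time)
    then show ?thesis using that by (simp add: z_def Z_def duhamel_def adj.linear_time)
  qed
  have y: "y t = S t y0 + duhamel S F 0 t" if "t \<in> {0..T}" for t
    using that by (simp add: y_def duhamel_def linear_time)
  have "inner (y T) zT = inner (S T y0) zT + L2_inner T F (\<lambda>s. ?Sa (T - s) zT)"
  proof -
    have "duhamel S F 0 T = integral {0..T} (\<lambda>s. S (max 0 (T - s)) (F s))"
      using \<open>T \<ge> 0\<close> by (auto simp: duhamel_def linear_time intro!: integral_cong)
    then have "inner (duhamel S F 0 T) zT = L2_inner T (\<lambda>s. S (max 0 (T - s)) (F s)) (\<lambda>s. zT)"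
      using inner_integral_L2[OF \<open>T \<ge> 0\<close> L2_transport_backward[OF F, of T]] \<open>T \<ge> 0\<close>
      by (simp add: L2_inner_def)
    also have "\<dots> = L2_inner T F (\<lambda>s. ?Sa (T - s) zT)" by (intro L2_inner_cong) (simp add: adj)
    finally show ?thesis using y[of T] \<open>T \<ge> 0\<close> by (simp add: inner_add_left)
  qed
  moreover have "inner y0 (z 0) = inner (S T y0) zT - L2_inner T (\<lambda>t. S t y0) f"
  proof -
    have int: "(\<lambda>t. ?Sa (max 0 (t - 0)) (f t)) \<in> L2 T"
      by (rule adj.L2_transport_forward[OF f]) (use \<open>T \<ge> 0\<close> in auto)
    have "Z 0 = integral {0..T} (\<lambda>r. ?Sa (max 0 (T - r - 0)) (f (T - r)))"
      using \<open>T \<ge> 0\<close> by (auto simp: Z_def duhamel_def adj.linear_time intro!: integral_cong)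
    also have "\<dots> = integral {0..T} (\<lambda>t. ?Sa (max 0 (t - 0)) (f t))"
      using has_integral_reflection[OF integrable_integral[OF L2_integrable_on[OF \<open>T \<ge> 0\<close> int]]]
      by (simp add: integral_unique)
    finally have "inner (Z 0) y0 = L2_inner T (\<lambda>t. ?Sa (max 0 (t - 0)) (f t)) (\<lambda>t. y0)"
      using inner_integral_L2[OF \<open>T \<ge> 0\<close> int] by (simp add: L2_inner_def)
    also have "\<dots> = L2_inner T (\<lambda>t. S t y0) f"
      by (intro L2_inner_cong) (simp add: adj inner_commute[of _ y0])
    finally show ?thesis
      using z[of 0] \<open>T \<ge> 0\<close> by (simp add: inner_diff_right adj inner_commute[of y0 "Z 0"])
  qed
  moreover have "L2_inner T F z = L2_inner T F (\<lambda>s. ?Sa (T - s) zT) - L2_inner T F Z"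
  proof -
    have "L2_inner T F z = L2_inner T (\<lambda>s. ?Sa (T - s) zT - Z s) F"
      by (intro L2_inner_cong) (simp add: z inner_commute)
    then show ?thesis using L2_inner_diff_left[OF p Z F] by (simp add: L2_inner_commute)
  qed
  moreover have "L2_inner T y f = L2_inner T (\<lambda>t. S t y0) f + L2_inner T (duhamel S F 0) f"
  proof -
    have "L2_inner T y f = L2_inner T (\<lambda>t. S t y0 + duhamel S F 0 t) f"
      by (intro L2_inner_cong) (simp add: y)
    then show ?thesis using L2_inner_add_left[OF q L2_duhamel[OF F] f] by simp
  qed
  moreover have "L2_inner T (duhamel S F 0) f = L2_inner T F Z"
    using volterra_duality[OF assms(1-3)] by (simp add: Z_def[abs_def])
  ultimately show ?thesis by simp
qed

end

section \<open>From observability to controllability\<close>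

text \<open>
  The Riesz theorem for a functional defined on a family of functions \<open>\<Lambda> p\<close>. It is stated in terms of
  the parameters \<open>p\<close>, on which the functional is given; the bound forces it to depend on
  \<open>\<Lambda> p\<close> only.
\<close>

lemma L2_riesz:
  fixes \<Lambda> :: "'a \<Rightarrow> real \<Rightarrow> 'x::{real_inner, banach}"
  assumes "T \<ge> 0" "D \<noteq> {}"
    and add: "\<And>p q. p \<in> D \<Longrightarrow> q \<in> D \<Longrightarrow> add p q \<in> D"
    and scl: "\<And>r p. p \<in> D \<Longrightarrow> scl r p \<in> D"
    and L2: "\<And>p. p \<in> D \<Longrightarrow> \<Lambda> p \<in> L2 T"
    and \<Lambda>_add: "\<And>p q t. p \<in> D \<Longrightarrow> q \<in> D \<Longrightarrow> t \<in> {0..T} \<Longrightarrow> \<Lambda> (add p q) t = \<Lambda> p t + \<Lambda> q t"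
    and \<Lambda>_scl: "\<And>r p t. p \<in> D \<Longrightarrow> t \<in> {0..T} \<Longrightarrow> \<Lambda> (scl r p) t = r *\<^sub>R \<Lambda> p t"
    and c_add: "\<And>p q. p \<in> D \<Longrightarrow> q \<in> D \<Longrightarrow> c (add p q) = c p + c q"
    and c_scl: "\<And>r p. p \<in> D \<Longrightarrow> c (scl r p) = r * c p"
    and bound: "\<And>p. p \<in> D \<Longrightarrow> c p \<le> K * L2_norm T (\<Lambda> p)"
  obtains h where "h \<in> L2 T" and "\<And>p. p \<in> D \<Longrightarrow> L2_inner T h (\<Lambda> p) = c p"
proof -
  let ?ip = "\<lambda>p q. L2_inner T (\<Lambda> p) (\<Lambda> q)"
  obtain x :: "nat \<Rightarrow> 'a" where x: "\<And>n. x n \<in> D"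
    and cau: "\<And>e. e > 0 \<Longrightarrow>
      \<exists>N. \<forall>m\<ge>N. \<forall>n\<ge>N. ?ip (x m) (x m) - 2 * ?ip (x m) (x n) + ?ip (x n) (x n) < e"
    and lim: "\<And>a. a \<in> D \<Longrightarrow> (\<lambda>n. ?ip (x n) a) \<longlonglongrightarrow> c a"
  proof (rule riesz_minimizing_sequence[of D add scl ?ip c K])
    fix p q d r assume pq: "p \<in> D" "q \<in> D" "d \<in> D"
    have "?ip (add p q) d = L2_inner T (\<lambda>t. \<Lambda> p t + \<Lambda> q t) (\<Lambda> d)"
      by (intro L2_inner_cong) (simp add: \<Lambda>_add pq)
    then show "?ip (add p q) d = ?ip p d + ?ip q d" using pq by (simp add: L2_inner_add_left L2)
    have "?ip (scl r p) d = L2_inner T (\<lambda>t. r *\<^sub>R \<Lambda> p t) (\<Lambda> d)"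
      by (intro L2_inner_cong) (simp add: \<Lambda>_scl pq)
    then show "?ip (scl r p) d = r * ?ip p d" by (simp add: L2_inner_scaleR_left)
  qed (use assms that in \<open>auto simp: L2_inner_self L2_norm_nonneg L2_inner_commute\<close>)
  have "\<exists>N. \<forall>m\<ge>N. \<forall>n\<ge>N. L2_norm T (\<lambda>t. \<Lambda> (x m) t - \<Lambda> (x n) t) < e" if "e > 0" for e
  proof -
    obtain N where N: "\<forall>m\<ge>N. \<forall>n\<ge>N. ?ip (x m) (x m) - 2 * ?ip (x m) (x n) + ?ip (x n) (x n) < e\<^sup>2"
      using cau[of "e\<^sup>2"] \<open>e > 0\<close> by auto
    have "L2_norm T (\<lambda>t. \<Lambda> (x m) t - \<Lambda> (x n) t) < e" if "m \<ge> N" "n \<ge> N" for m n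
    proof (rule power_less_imp_less_base[of _ 2])
      have L: "\<Lambda> (x m) \<in> L2 T" "\<Lambda> (x n) \<in> L2 T" using x L2 by auto
      have "(L2_norm T (\<lambda>t. \<Lambda> (x m) t - \<Lambda> (x n) t))\<^sup>2
          = ?ip (x m) (x m) - 2 * ?ip (x m) (x n) + ?ip (x n) (x n)"
        using L unfolding L2_inner_self[symmetric]
        by (simp add: L2_inner_diff_left L2_diff L2_inner_commute[of T "\<Lambda> _" "\<lambda>t. _ t - _ t"]
            L2_inner_commute[of T "\<Lambda> (x n)" "\<Lambda> (x m)"])
      then show "(L2_norm T (\<lambda>t. \<Lambda> (x m) t - \<Lambda> (x n) t))\<^sup>2 < e\<^sup>2" using N that by auto
    qed (use \<open>e > 0\<close> in simp)
    then show ?thesis by blast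
  qed
  then obtain h where h: "h \<in> L2 T" and hlim: "(\<lambda>n. L2_norm T (\<lambda>t. \<Lambda> (x n) t - h t)) \<longlonglongrightarrow> 0"
    using L2_complete[OF \<open>T \<ge> 0\<close>, of "\<lambda>n. \<Lambda> (x n)"] x L2 by blast
  show thesis
  proof (rule that[OF h])
    fix p assume p: "p \<in> D"
    have "(\<lambda>n. ?ip (x n) p - L2_inner T h (\<Lambda> p)) \<longlonglongrightarrow> 0"
    proof (rule Lim_null_comparison[OF always_eventually[OF allI]])
      fix n
      show "norm (?ip (x n) p - L2_inner T h (\<Lambda> p))
          \<le> L2_norm T (\<lambda>t. \<Lambda> (x n) t - h t) * L2_norm T (\<Lambda> p)"
        using L2_inner_le[OF L2_diff[OF L2[OF x] h] L2[OF p]] by (simp add: L2_inner_diff_left L2 x p h)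
      show "(\<lambda>n. L2_norm T (\<lambda>t. \<Lambda> (x n) t - h t) * L2_norm T (\<Lambda> p)) \<longlonglongrightarrow> 0"
        using tendsto_mult_right[OF hlim, of "L2_norm T (\<Lambda> p)"] by simp
    qed
    then have "(\<lambda>n. ?ip (x n) p) \<longlonglongrightarrow> L2_inner T h (\<Lambda> p)" by (rule LIM_zero_cancel)
    then show "L2_inner T h (\<Lambda> p) = c p" using lim[OF p] LIMSEQ_unique by blast
  qed
qed

lemma L2_norm_mono:
  assumes f: "f \<in> L2 T" and g: "g \<in> L2 T" and le: "\<And>t. t \<in> {0..T} \<Longrightarrow> norm (f t) \<le> norm (g t)"
  shows "L2_norm T f \<le> L2_norm T g"
  unfolding L2_norm_def
  using le by (intro real_sqrt_le_mono integral_mono L2_square_integrable f g power_mono) auto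


lemma L2_norm_reflection:
  assumes f: "f \<in> L2 T"
  shows "L2_norm T (\<lambda>t. f (T - t)) = L2_norm T f"
  unfolding L2_norm_def
  using integral_reflection[OF borel_measurable_integrable[OF L2_square_integrable[OF f]]] by simp

lemma L2_inner_Pair:
  fixes h :: "real \<Rightarrow> 'u::real_inner \<times> 'h::real_inner"
  assumes "h \<in> L2 T" "a \<in> L2 T" "b \<in> L2 T"
  shows "L2_inner T h (\<lambda>t. (a t, b t)) = L2_inner T (\<lambda>t. fst (h t)) a + L2_inner T (\<lambda>t. snd (h t)) b"
  using assms unfolding L2_inner_def
  by (simp add: inner_prod_def integrable_L2_inner L2_bounded_linear bounded_linear_fst bounded_linear_snd)

theorem corollary1p3:
  fixes A :: "('h::{real_inner, banach} \<times> 'h) set"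
    and B :: "'u::{real_inner, banach} \<Rightarrow> 'h"
    and T :: real
    and G :: "(real \<Rightarrow> 'u) set"
    and W :: "(real \<Rightarrow> 'h) set"
  assumes "\<exists>S. generates A S"
    and "bounded_linear B"
    and "T > 0"
    and "closed_subspace_L2 T G"
    and "closed_subspace_L2 T W"
    and "\<exists>C>0. \<forall>zT. \<forall>g\<in>G. \<forall>w\<in>W. \<forall>f\<in>L2 T. \<forall>z.
           backward_mild_solution (adjoint_op A) T f zT z \<longrightarrow>
           sqrt ((norm zT)\<^sup>2 + (L2_norm T g)\<^sup>2 + (L2_norm T w)\<^sup>2 + (L2_norm T f)\<^sup>2)
             \<le> C * (L2_norm T (\<lambda>t. adjoint B (z t) + g t) + L2_norm T (\<lambda>t. f t + w t))"
  shows "\<forall>y0 y1. \<forall>g\<^sub>0\<in>G. \<forall>w\<^sub>0\<in>W. \<exists>u\<in>L2 T.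
           is_L2_projection T G u g\<^sub>0 \<and>
           (\<exists>y. mild_solution A T (\<lambda>t. B (u t)) y0 y \<and> y T = y1 \<and> is_L2_projection T W y w\<^sub>0)"
proof (intro allI ballI)
  fix y0 y1 :: 'h and g\<^sub>0 :: "real \<Rightarrow> 'u" and w\<^sub>0 :: "real \<Rightarrow> 'h"
  assume g0: "g\<^sub>0 \<in> G" and w0: "w\<^sub>0 \<in> W"
  obtain S where S: "C0_semigroup S" and A: "A = generator S"
    using assms(1) by (auto simp: generates_def)
  let ?Sa = "\<lambda>t. adjoint (S t)"
  interpret S: hilbert_semigroup S by standard (rule S)
  interpret adj: hilbert_semigroup ?Sa by standard (rule adjoint_C0_semigroup[OF S])
  have A': "adjoint_op A = generator ?Sa" by (simp add: A generator_adjoint[OF S])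
  note B = \<open>bounded_linear B\<close>
  have "T \<ge> 0" using \<open>T > 0\<close> by simp
  have G: "G \<subseteq> L2 T" "(\<lambda>t. 0) \<in> G" "\<And>f g. f \<in> G \<Longrightarrow> g \<in> G \<Longrightarrow> (\<lambda>t. f t + g t) \<in> G"
      "\<And>c f. f \<in> G \<Longrightarrow> (\<lambda>t. c *\<^sub>R f t) \<in> G"
    using assms(4) by (auto simp: closed_subspace_L2_def)
  have W: "W \<subseteq> L2 T" "(\<lambda>t. 0) \<in> W" "\<And>f g. f \<in> W \<Longrightarrow> g \<in> W \<Longrightarrow> (\<lambda>t. f t + g t) \<in> W"
      "\<And>c f. f \<in> W \<Longrightarrow> (\<lambda>t. c *\<^sub>R f t) \<in> W"
    using assms(5) by (auto simp: closed_subspace_L2_def)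
  define z where "z zT f t = duhamel ?Sa (\<lambda>r. - f (T - r)) zT (T - t)" for zT f t
  have rhs: "(\<lambda>r. - f (T - r)) \<in> L2 T" if "f \<in> L2 T" for f :: "real \<Rightarrow> 'h"
    by (intro L2_minus L2_reflection that)
  have z_L2: "z zT f \<in> L2 T" if "f \<in> L2 T" for zT f
    unfolding z_def by (intro L2_reflection adj.L2_duhamel rhs that)
  have z_add: "z (a + b) (\<lambda>t. f t + g t) t = z a f t + z b g t"
    if "f \<in> L2 T" "g \<in> L2 T" "t \<in> {0..T}" for a b f g t
    using adj.duhamel_add[OF rhs[OF that(1)] rhs[OF that(2)], of "T - t" a b] that(3)
    by (simp add: z_def)
  have z_scl: "z (c *\<^sub>R a) (\<lambda>t. c *\<^sub>R f t) t = c *\<^sub>R z a f t" if "t \<in> {0..T}" for c a f t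
    using adj.duhamel_scaleR[of "T - t" c "\<lambda>r. - f (T - r)" a] that by (simp add: z_def)
  have z_0: "z 0 (\<lambda>t. 0) t = 0" if "t \<in> {0..T}" for t
    using z_scl[OF that, of 0 0 "\<lambda>t. 0"] by simp
  have B_adj: "bounded_linear (adjoint B)" by (rule bounded_linear_adjoint[OF B])
  have Bz: "(\<lambda>t. adjoint B (z zT f t)) \<in> L2 T" if "f \<in> L2 T" for zT f
    by (rule L2_bounded_linear[OF B_adj z_L2[OF that]])
  have zero: "(\<lambda>t. 0) \<in> L2 T" by (rule L2_const)

  \<comment> \<open>\<open>\<Lambda>\<close> maps the test data to the right-hand side of the observability inequality\<close>
  define D where "D = (UNIV :: 'h set) \<times> G \<times> W \<times> (L2 T :: (real \<Rightarrow> 'h) set)"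
  define \<Lambda> where "\<Lambda> = (\<lambda>(zT, g, w, f) t. (adjoint B (z zT f t) + g t, f t + w t))"
  define c where "c = (\<lambda>(zT, g, w, f).
    L2_inner T g\<^sub>0 g + L2_inner T w\<^sub>0 w + inner y1 zT - inner y0 (z zT f 0))"
  define add :: "'h \<times> (real \<Rightarrow> 'u) \<times> (real \<Rightarrow> 'h) \<times> (real \<Rightarrow> 'h) \<Rightarrow> _ \<Rightarrow> _"
    where "add = (\<lambda>(a, g, w, f) (a', g', w', f').
      (a + a', \<lambda>t. g t + g' t, \<lambda>t. w t + w' t, \<lambda>t. f t + f' t))"
  define scl :: "real \<Rightarrow> 'h \<times> (real \<Rightarrow> 'u) \<times> (real \<Rightarrow> 'h) \<times> (real \<Rightarrow> 'h) \<Rightarrow> _"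
    where "scl = (\<lambda>r (a, g, w, f). (r *\<^sub>R a, \<lambda>t. r *\<^sub>R g t, \<lambda>t. r *\<^sub>R w t, \<lambda>t. r *\<^sub>R f t))"
  have pair: "(\<lambda>t. adjoint B (z zT f t) + g t) \<in> L2 T" "(\<lambda>t. f t + w t) \<in> L2 T"
    if "g \<in> G" "w \<in> W" "f \<in> L2 T" for zT g w f
    using that G(1) W(1) by (auto intro: L2_add Bz)

  \<comment> \<open>observability turns the trivial bound of \<open>c\<close> by the data into a bound by \<open>\<Lambda>\<close>\<close>
  obtain K where K: "\<And>p. p \<in> D \<Longrightarrow> c p \<le> K * L2_norm T (\<Lambda> p)"
  proof -
    obtain C where "C > 0" and C: "\<And>zT g w f z. g \<in> G \<Longrightarrow> w \<in> W \<Longrightarrow> f \<in> L2 T \<Longrightarrow>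
        backward_mild_solution (adjoint_op A) T f zT z \<Longrightarrow>
        sqrt ((norm zT)\<^sup>2 + (L2_norm T g)\<^sup>2 + (L2_norm T w)\<^sup>2 + (L2_norm T f)\<^sup>2)
          \<le> C * (L2_norm T (\<lambda>t. adjoint B (z t) + g t) + L2_norm T (\<lambda>t. f t + w t))"
      using assms(6) by blast
    obtain M where "M \<ge> 1" and M: "\<And>s y. s \<in> {0..T} \<Longrightarrow> norm (?Sa s y) \<le> M * norm y"
      by (rule adj.bounded_on_interval[of T]) (rule that)
    define k where "k = L2_norm T g\<^sub>0 + L2_norm T w\<^sub>0 + norm y1 + norm y0 * (M + M * sqrt T)"
    have "k \<ge> 0" using \<open>M \<ge> 1\<close> \<open>T \<ge> 0\<close> by (simp add: k_def L2_norm_nonneg)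
    have "c p \<le> (k * (C * 2)) * L2_norm T (\<Lambda> p)" if "p \<in> D" for p
    proof -
      obtain zT g w f where p: "p = (zT, g, w, f)" by (cases p) auto
      with \<open>p \<in> D\<close> have gwf: "g \<in> G" "w \<in> W" "f \<in> L2 T" by (auto simp: D_def)
      then have gw: "g \<in> L2 T" "w \<in> L2 T" "g\<^sub>0 \<in> L2 T" "w\<^sub>0 \<in> L2 T"
        using G(1) W(1) g0 w0 by auto
      define N where "N = sqrt ((norm zT)\<^sup>2 + (L2_norm T g)\<^sup>2 + (L2_norm T w)\<^sup>2 + (L2_norm T f)\<^sup>2)"
      have N: "norm zT \<le> N" "L2_norm T g \<le> N" "L2_norm T w \<le> N" "L2_norm T f \<le> N"
        unfolding N_def by (auto intro!: real_le_rsqrt)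
      have "backward_mild_solution (adjoint_op A) T f zT (z zT f)"
        using adj.mild_solution_duhamel[OF A' rhs[OF gwf(3)], of zT]
        by (simp add: backward_mild_solution_def z_def)
      then have "N \<le> C * (L2_norm T (\<lambda>t. adjoint B (z zT f t) + g t) + L2_norm T (\<lambda>t. f t + w t))"
        unfolding N_def by (rule C[OF gwf])
      also have "\<dots> \<le> C * (L2_norm T (\<Lambda> p) + L2_norm T (\<Lambda> p))"
      proof (intro mult_left_mono add_mono)
        have "\<Lambda> p \<in> L2 T" unfolding \<Lambda>_def p using L2_Pair[OF pair[OF gwf]] by simp
        then show "L2_norm T (\<lambda>t. adjoint B (z zT f t) + g t) \<le> L2_norm T (\<Lambda> p)"
          "L2_norm T (\<lambda>t. f t + w t) \<le> L2_norm T (\<Lambda> p)"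
          by (auto intro!: L2_norm_mono pair gwf simp: \<Lambda>_def p norm_fst_le norm_snd_le)
      qed (use \<open>C > 0\<close> in simp)
      finally have NC: "N \<le> (C * 2) * L2_norm T (\<Lambda> p)" by simp
      have "norm (z zT f 0) \<le> M * norm zT + M * (sqrt T * L2_norm T (\<lambda>r. - f (T - r)))"
        unfolding z_def using \<open>T \<ge> 0\<close> \<open>M \<ge> 1\<close> by (intro adj.norm_duhamel_le rhs gwf M) auto
      also have "L2_norm T (\<lambda>r. - f (T - r)) = L2_norm T f"
        using L2_norm_reflection[OF gwf(3)] by (simp add: L2_norm_def)
      also have "M * norm zT + M * (sqrt T * L2_norm T f) \<le> M * N + M * (sqrt T * N)"
        using \<open>M \<ge> 1\<close> \<open>T \<ge> 0\<close> by (intro add_mono mult_left_mono N) auto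
      finally have z0: "norm (z zT f 0) \<le> (M + M * sqrt T) * N" by (simp add: algebra_simps)
      have "c p = L2_inner T g\<^sub>0 g + L2_inner T w\<^sub>0 w + inner y1 zT - inner y0 (z zT f 0)"
        by (simp add: c_def p)
      also have "\<dots> \<le> L2_norm T g\<^sub>0 * N + L2_norm T w\<^sub>0 * N + norm y1 * N + norm y0 * ((M + M * sqrt T) * N)"
      proof -
        have "L2_inner T g\<^sub>0 g \<le> L2_norm T g\<^sub>0 * N"
          using L2_inner_le[OF gw(3,1)] mult_left_mono[OF N(2) L2_norm_nonneg[of T g\<^sub>0]] by linarith
        moreover have "L2_inner T w\<^sub>0 w \<le> L2_norm T w\<^sub>0 * N"
          using L2_inner_le[OF gw(4,2)] mult_left_mono[OF N(3) L2_norm_nonneg[of T w\<^sub>0]] by linarith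
        moreover have "inner y1 zT \<le> norm y1 * N"
          using norm_cauchy_schwarz[of y1 zT] mult_left_mono[OF N(1) norm_ge_zero[of y1]] by linarith
        moreover have "- inner y0 (z zT f 0) \<le> norm y0 * ((M + M * sqrt T) * N)"
          using Cauchy_Schwarz_ineq2[of y0 "z zT f 0"] mult_left_mono[OF z0 norm_ge_zero[of y0]] by linarith
        ultimately show ?thesis by linarith
      qed
      also have "\<dots> = k * N" by (simp add: k_def algebra_simps)
      also have "\<dots> \<le> k * ((C * 2) * L2_norm T (\<Lambda> p))" by (rule mult_left_mono[OF NC \<open>k \<ge> 0\<close>])
      finally show ?thesis by (simp add: mult_ac)
    qed
    then show thesis by (rule that)
  qed

  obtain h where h: "h \<in> L2 T" and h_eq: "\<And>p. p \<in> D \<Longrightarrow> L2_inner T h (\<Lambda> p) = c p"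
  proof (rule L2_riesz[of T D add scl \<Lambda> c K])
    show "D \<noteq> {}" using G(2) W(2) zero by (auto simp: D_def)
    fix p q r t assume p: "p \<in> D" and q: "q \<in> D"
    obtain a g w f where p': "p = (a, g, w, f)" by (cases p) auto
    obtain a' g' w' f' where q': "q = (a', g', w', f')" by (cases q) auto
    have in_L2: "g \<in> L2 T" "w \<in> L2 T" "f \<in> L2 T" "g' \<in> L2 T" "w' \<in> L2 T" "f' \<in> L2 T"
        "g\<^sub>0 \<in> L2 T" "w\<^sub>0 \<in> L2 T"
      using p q g0 w0 G(1) W(1) by (auto simp: D_def p' q')
    show "add p q \<in> D" using p q by (auto simp: D_def add_def p' q' G W L2_add)
    show "scl r p \<in> D" using p by (auto simp: D_def scl_def p' G W L2_scaleR)
    show "\<Lambda> p \<in> L2 T" using p L2_Pair[OF pair] by (auto simp: D_def \<Lambda>_def p')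
    show "\<Lambda> (add p q) t = \<Lambda> p t + \<Lambda> q t" if "t \<in> {0..T}"
      using z_add[OF in_L2(3,6) that] bounded_linear.linear[OF B_adj]
      by (simp add: \<Lambda>_def add_def p' q' linear_add)
    show "\<Lambda> (scl r p) t = r *\<^sub>R \<Lambda> p t" if "t \<in> {0..T}"
      using z_scl[OF that] bounded_linear.linear[OF B_adj]
      by (simp add: \<Lambda>_def scl_def p' linear_scale scaleR_add_right)
    show "c (add p q) = c p + c q"
      using z_add[OF in_L2(3,6), of 0] \<open>T \<ge> 0\<close> in_L2
      by (simp add: c_def add_def p' q' L2_inner_add_right inner_add_right)
    show "c (scl r p) = r * c p"
      using z_scl[of 0] \<open>T \<ge> 0\<close> by (simp add: c_def scl_def p' L2_inner_scaleR_right algebra_simps)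
    show "c p \<le> K * L2_norm T (\<Lambda> p)" by (rule K[OF p])
  qed (use \<open>T \<ge> 0\<close> that in auto)
  define u v where "u t = fst (h t)" and "v t = snd (h t)" for t
  have u: "u \<in> L2 T" and v: "v \<in> L2 T"
    using L2_bounded_linear[OF bounded_linear_fst h] L2_bounded_linear[OF bounded_linear_snd h]
    by (simp_all add: u_def[abs_def] v_def[abs_def])
  have euler: "L2_inner T u (\<lambda>t. adjoint B (z zT f t) + g t) + L2_inner T v (\<lambda>t. f t + w t)
      = L2_inner T g\<^sub>0 g + L2_inner T w\<^sub>0 w + inner y1 zT - inner y0 (z zT f 0)"
    if "g \<in> G" "w \<in> W" "f \<in> L2 T" for zT g w f
  proof -
    have "(zT, g, w, f) \<in> D" using that by (simp add: D_def)
    from h_eq[OF this] L2_inner_Pair[OF h pair[OF that]] show ?thesis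
      by (simp add: \<Lambda>_def c_def u_def[abs_def] v_def[abs_def])
  qed
  have inner_0: "L2_inner T f (\<lambda>t. 0) = 0" for f :: "real \<Rightarrow> 'b::real_inner"
    by (simp add: L2_inner_def)
  \<comment> \<open>zero final datum and source give \<open>z = 0\<close>, which isolates \<open>g\<close> here and \<open>w\<close> below\<close>
  have test_g: "L2_inner T u g = L2_inner T g\<^sub>0 g" if "g \<in> G" for g
  proof -
    have "L2_inner T u (\<lambda>t. adjoint B (z 0 (\<lambda>t. 0) t) + g t) = L2_inner T u g"
      by (intro L2_inner_cong) (simp add: z_0 B_adj bounded_linear.linear linear_0)
    then show ?thesis
      using euler[OF that W(2) zero, of 0] \<open>T \<ge> 0\<close> by (simp add: inner_0 z_0)
  qed
  have test_w: "L2_inner T v w = L2_inner T w\<^sub>0 w" if "w \<in> W" for w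
  proof -
    have "L2_inner T u (\<lambda>t. adjoint B (z 0 (\<lambda>t. 0) t) + 0) = L2_inner T u (\<lambda>t. 0)"
      by (intro L2_inner_cong) (simp add: z_0 B_adj bounded_linear.linear linear_0)
    then show ?thesis
      using euler[OF G(2) that zero, of 0] \<open>T \<ge> 0\<close> by (simp add: inner_0 z_0)
  qed
  define y where "y = duhamel S (\<lambda>t. B (u t)) y0"
  have Bu: "(\<lambda>t. B (u t)) \<in> L2 T" by (rule L2_bounded_linear[OF B u])
  have y: "y \<in> L2 T" unfolding y_def by (rule S.L2_duhamel[OF Bu])
  \<comment> \<open>the Euler equation minus the integration by parts formula\<close>
  have key: "L2_inner T v f - L2_inner T y f = inner (y1 - y T) zT" if f: "f \<in> L2 T" for zT f
  proof -
    have "L2_inner T (\<lambda>t. B (u t)) (z zT f) = L2_inner T u (\<lambda>t. adjoint B (z zT f t) + 0)"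
      by (intro L2_inner_cong) (simp add: inner_adjoint[OF B])
    moreover have "inner (y T) zT - inner y0 (z zT f 0)
        = L2_inner T (\<lambda>t. B (u t)) (z zT f) + L2_inner T y f"
      using S.duality[OF \<open>T \<ge> 0\<close> Bu f, of y0 zT] by (simp add: y_def z_def[abs_def])
    ultimately show ?thesis
      using euler[OF G(2) W(2) f, of zT] by (simp add: inner_0 inner_diff_left)
  qed
  have yT: "y T = y1" using key[OF zero, of "y1 - y T"] by (simp add: inner_0)
  then have vy: "L2_inner T v f = L2_inner T y f" if "f \<in> L2 T" for f
    using key[OF that, of 0] by simp
  show "\<exists>u\<in>L2 T. is_L2_projection T G u g\<^sub>0 \<and>
      (\<exists>y. mild_solution A T (\<lambda>t. B (u t)) y0 y \<and> y T = y1 \<and> is_L2_projection T W y w\<^sub>0)"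
  proof (intro bexI[OF _ u] conjI exI[of _ y])
    show "is_L2_projection T G u g\<^sub>0"
      unfolding is_L2_projection_def using u g0 G(1) test_g by (auto simp: L2_inner_diff_left subset_iff)
    show "mild_solution A T (\<lambda>t. B (u t)) y0 y"
      unfolding y_def by (rule S.mild_solution_duhamel[OF A Bu])
    show "y T = y1" by (rule yT)
    show "is_L2_projection T W y w\<^sub>0"
      unfolding is_L2_projection_def using y w0 W(1) test_w vy by (auto simp: L2_inner_diff_left subset_iff)
  qed
qed

end
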